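(* Let $A$ be an associative unital ring containing three pairwise orthogonal full idempotents $e_1,e_2,e_3$ with $e_1+e_2+e_3=1$. Let $B$ be another associative ring, and let $\varphi:[A,A]\to[B,B]$ be an arbitrary isomorphism of Lie rings. Then $\varphi$ extends to a standard mapping $A\to B$; that is, there exists a standard additive mapping $\Phi:A\to B$ such that $\Phi(a)=\varphi(a)$ for all $a\in[A,A]$.
   Context: Rings are associative and not necessarily unital unless stated otherwise, and homomorphisms are not required to preserve identity elements. For a ring $R$ write $[a,b]=ab-ba$; $[R,R]$ is the additive subgroup generated by all commutators $[a,b]$, $a,b\in R$, viewed as a Lie ring under $[\,,\,]$. For an idempotent $e$, $AeA$ is the additive subgroup generated by all products $aeb$, $a,b\in A$; the idempotent $e\in A$ is full if $AeA=A$. An anti-homomorphism $\psi:A\to B$ is an additive map with $\psi(ab)=\psi(b)\psi(a)$. An additive mapping $\Phi:A\to B$ is called standard if there exist a ring homomorphism $\psi_1:A\to B$ and an anti-homomorphism $\psi_2:A\to B$ such that (i) $\psi_1(A)\psi_2(A)=\psi_2(A)\psi_1(A)=(0)$ and (ii) $\Phi=\psi_1-\psi_2$. *)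

theory Defs
  imports Complex_Main "HOL-Computational_Algebra.Group_Closure"
begin

definition lie_bracket :: "'a::ring \<Rightarrow> 'a \<Rightarrow> 'a"
  where "lie_bracket a b = a * b - b * a"

definition commutator_subgroup :: "'a::ring set"
  where "commutator_subgroup = group_closure {lie_bracket a b | a b. True}"

definition full_idempotent :: "'a::ring \<Rightarrow> bool"
  where "full_idempotent e \<longleftrightarrow> e * e = e \<and> group_closure {a * e * b | a b. True} = UNIV"

definition orthogonal_elements :: "'a::ring \<Rightarrow> 'a \<Rightarrow> bool"
  where "orthogonal_elements e f \<longleftrightarrow> e * f = 0 \<and> f * e = 0"

definition ring_homomorphism :: "('a::ring \<Rightarrow> 'b::ring) \<Rightarrow> bool"
  where "ring_homomorphism \<psi> \<longleftrightarrow> additive \<psi> \<and> (\<forall>a b. \<psi> (a * b) = \<psi> a * \<psi> b)"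

definition ring_antihomomorphism :: "('a::ring \<Rightarrow> 'b::ring) \<Rightarrow> bool"
  where "ring_antihomomorphism \<psi> \<longleftrightarrow> additive \<psi> \<and> (\<forall>a b. \<psi> (a * b) = \<psi> b * \<psi> a)"

definition standard_map :: "('a::ring \<Rightarrow> 'b::ring) \<Rightarrow> bool"
  where "standard_map \<Phi> \<longleftrightarrow> additive \<Phi> \<and>
    (\<exists>\<psi>\<^sub>1 \<psi>\<^sub>2. ring_homomorphism \<psi>\<^sub>1 \<and> ring_antihomomorphism \<psi>\<^sub>2 \<and>
      (\<forall>a b. \<psi>\<^sub>1 a * \<psi>\<^sub>2 b = 0 \<and> \<psi>\<^sub>2 a * \<psi>\<^sub>1 b = 0) \<and>
      (\<forall>a. \<Phi> a = \<psi>\<^sub>1 a - \<psi>\<^sub>2 a))"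

text \<open>A map between Lie subrings is represented by a total function; only its values on
  the domain \<^term>\<open>L\<close> are constrained.\<close>

definition lie_ring_iso_on :: "'a::ring set \<Rightarrow> 'b::ring set \<Rightarrow> ('a \<Rightarrow> 'b) \<Rightarrow> bool"
  where "lie_ring_iso_on L M \<phi> \<longleftrightarrow> bij_betw \<phi> L M \<and>
    (\<forall>x\<in>L. \<forall>y\<in>L. \<phi> (x + y) = \<phi> x + \<phi> y) \<and>
    (\<forall>x\<in>L. \<forall>y\<in>L. \<phi> (lie_bracket x y) = lie_bracket (\<phi> x) (\<phi> y))"

text \<open>The sort \<open>{ring, monoid_mult}\<close> describes associative unital rings; unlike
  \<^class>\<open>ring_1\<close> it does not exclude the zero ring. The class \<^class>\<open>ring\<close>
  does not require a multiplicative identity.\<close>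

end

theory Submission
  imports Defs
begin

text \<open>
  Put \<open>A\<^sub>i\<^sub>j = e\<^sub>i A e\<^sub>j\<close>. Because the idempotents are full, \<open>A\<^sub>i\<^sub>j\<close> is spanned by the products from
  \<open>A\<^sub>i\<^sub>k A\<^sub>k\<^sub>j\<close>, for all \<open>i\<close>, \<open>j\<close>, \<open>k\<close>. So the off-diagonal components generate the ring \<open>A\<close>, they lie
  in \<open>L = [A,A]\<close>, and together with the brackets \<open>[A\<^sub>i\<^sub>j, A\<^sub>j\<^sub>i]\<close> they span \<open>L\<close>. If \<open>\<phi>\<close> is to extend to
  \<open>\<psi>\<^sub>1 - \<psi>\<^sub>2\<close>, then for \<open>a\<close> in \<open>A\<^sub>i\<^sub>j\<close> and \<open>b\<close> in \<open>A\<^sub>j\<^sub>k\<close> with \<open>i\<close>, \<open>j\<close>, \<open>k\<close> distinct one must have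
  \<open>\<psi>\<^sub>1(ab) = \<phi>(a)\<phi>(b)\<close> and \<open>\<psi>\<^sub>2(ab) = \<phi>(b)\<phi>(a)\<close>. The proof turns this into a definition, and for that
  it computes the associative products in \<open>B\<close> of images of off-diagonal elements.

  What makes these products accessible is that the range of \<open>\<phi>\<close> contains every commutator of \<open>B\<close>: if
  \<open>\<phi>(a)\<close> and \<open>\<phi>(b)\<close> commute, then \<open>\<phi>(a)[t,\<phi>(b)] = [\<phi>(a)t,\<phi>(b)]\<close> is again in the range, for any \<open>t\<close>
  in \<open>B\<close>. Consequently \<open>\<phi>(a)\<phi>(p) = \<phi>(z)\<close> with \<open>z\<close> in \<open>L\<close> for \<open>a\<close> in \<open>A\<^sub>i\<^sub>j\<close> and \<open>p\<close> in \<open>A\<^sub>j\<^sub>k\<close>. Brackets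
  of \<open>z\<close> with elements of \<open>L\<close> can be evaluated on the side of \<open>B\<close>, and since an element that commutes
  with some \<open>A\<^sub>m\<^sub>n\<close> has many vanishing Peirce components, this pins \<open>z\<close> down step by step:

  \<^item> The product of two elements of \<open>\<phi>(A\<^sub>i\<^sub>k)\<close> is \<open>\<phi>(w)\<close> with \<open>w\<close> in \<open>A\<^sub>i\<^sub>k\<close>, and brackets \<open>[x,y]\<close> with \<open>x\<close>
    in \<open>A\<^sub>i\<^sub>j\<close> and \<open>y\<close> in \<open>A\<^sub>j\<^sub>i\<close> act on it as derivations. Summing them to \<open>e\<^sub>i\<close> gives \<open>w = 2w\<close>, hence
    \<open>w = 0\<close>, in every characteristic (\<open>root_space_product_zero\<close>). The products from two components
    in a common row or a common column then vanish as well (\<open>row_product_zero\<close>,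
    \<open>column_product_zero\<close>).
  \<^item> With these relations \<open>\<phi>(A\<^sub>i\<^sub>j)\<phi>(A\<^sub>j\<^sub>k)\<close> lies in \<open>\<phi>(A\<^sub>i\<^sub>k)\<close>; the point is that \<open>z\<close> has no central
    diagonal component (\<open>adjacent_product_peirce\<close>).

  So \<open>ab = z + (ab - z)\<close> with \<open>\<phi>(z) = \<phi>(a)\<phi>(b)\<close> and \<open>\<phi>(ab - z) = - \<phi>(b)\<phi>(a)\<close>, and this splits every
  \<open>A\<^sub>i\<^sub>k\<close> into a direct sum of a part on which \<open>\<phi>\<close> is multiplicative and a part on which \<open>-\<phi>\<close> is
  antimultiplicative (\<open>adjacent_product_split\<close>, \<open>parts_disjoint\<close>). Composing the two projections with
  \<open>\<phi>\<close> and \<open>-\<phi>\<close> gives additive maps on the off-diagonal components, which extend to a homomorphism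
  \<open>\<psi>\<^sub>1\<close> and an antihomomorphism \<open>\<psi>\<^sub>2\<close> of the whole ring (\<open>multiplicative_extension\<close>). The map
  \<open>\<psi>\<^sub>1 - \<psi>\<^sub>2\<close> preserves brackets and agrees with \<open>\<phi>\<close> off the diagonal, hence on all of \<open>L\<close>.
\<close>

section \<open>Peirce decompositions with three full idempotents\<close>

text \<open>
  An index type with exactly three elements: the third index \<open>k\<close> next to given \<open>i \<noteq> j\<close> exists and is
  unique, so that one argument covers all positions in the Peirce decomposition.
\<close>
datatype three = One | Two | Three

lemma UNIV_three: "UNIV = {One, Two, Three}"
  by (auto intro: three.exhaust)

instance three :: finite
  by standard (simp add: UNIV_three)

lemma ex_third: "\<exists>k::three. k \<noteq> i \<and> k \<noteq> j"
  by (cases i; cases j) auto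

lemma third_index:
  fixes i j k l :: three
  assumes "i \<noteq> j" "i \<noteq> k" "j \<noteq> k"
  shows "l = i \<or> l = j \<or> l = k"
  using assms by (cases i; cases j; cases k; cases l) auto

lemma additiveI_diff:
  fixes f :: "'x::ab_group_add \<Rightarrow> 'y::ab_group_add"
  assumes "\<And>x y. f (x - y) = f x - f y"
  shows "additive f"
proof
  fix x y
  have "f (x + y - y) = f (x + y) - f y"
    by (rule assms)
  then show "f (x + y) = f x + f y"
    by simp
qed

lemma commutator_mem: "x * y - y * x \<in> commutator_subgroup"
  unfolding commutator_subgroup_def
  by (rule group_closure.base) (auto simp: lie_bracket_def)

lemma commutator_diff:
  "x \<in> commutator_subgroup \<Longrightarrow> y \<in> commutator_subgroup \<Longrightarrow> x - y \<in> commutator_subgroup"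
  unfolding commutator_subgroup_def by (rule group_closure.diff)

lemma commutator_zero [simp]: "0 \<in> commutator_subgroup"
  unfolding commutator_subgroup_def by simp

lemma commutator_add:
  "x \<in> commutator_subgroup \<Longrightarrow> y \<in> commutator_subgroup \<Longrightarrow> x + y \<in> commutator_subgroup"
  unfolding commutator_subgroup_def by (rule group_closure_add)

locale peirce_frame =
  fixes e :: "three \<Rightarrow> 'a::{ring, monoid_mult}"
  assumes full: "full_idempotent (e i)"
    and orthogonal: "i \<noteq> j \<Longrightarrow> e i * e j = 0"
    and sum_one: "e One + e Two + e Three = 1"
begin

definition peirce :: "three \<Rightarrow> three \<Rightarrow> 'a set"
  where "peirce i j = {x. e i * x = x \<and> x * e j = x}"

lemma idem: "e i * e i = e i"
  using full[of i] by (simp add: full_idempotent_def)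

lemma e_mult: "e i * e j = (if i = j then e i else 0)"
  by (simp add: idem orthogonal)

lemma e_mult_left: "e i * (e j * x) = (if i = j then e i * x else 0)"
  by (simp add: mult.assoc[symmetric] e_mult)

lemma sum_distinct:
  assumes "i \<noteq> j" "i \<noteq> k" "j \<noteq> k"
  shows "e i + e j + e k = 1"
  using sum_one assms by (cases i; cases j; cases k) (auto simp: algebra_simps)

lemma peirce_decomposition:
  "x = (\<Sum>i\<in>UNIV. \<Sum>j\<in>UNIV. e i * x * e j)"
proof -
  have "x = (e One + e Two + e Three) * x * (e One + e Two + e Three)"
    by (simp add: sum_one)
  then show ?thesis
    by (simp add: UNIV_three algebra_simps)
qed

lemma peirce_left: "x \<in> peirce i j \<Longrightarrow> e k * x = (if k = i then x else 0)"
  unfolding peirce_def using e_mult_left[of k i x] by auto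

lemma peirce_right: "x \<in> peirce i j \<Longrightarrow> x * e k = (if k = j then x else 0)"
  unfolding peirce_def using e_mult[of j k] mult.assoc[of x "e j" "e k"] by auto

lemma peirce_component [simp]: "e i * x * e j \<in> peirce i j"
  by (simp add: peirce_def mult.assoc e_mult e_mult_left)

lemma peirce_zero [simp]: "0 \<in> peirce i j"
  by (simp add: peirce_def)

lemma peirce_diff: "x \<in> peirce i j \<Longrightarrow> y \<in> peirce i j \<Longrightarrow> x - y \<in> peirce i j"
  by (simp add: peirce_def algebra_simps)

lemma peirce_mult: "x \<in> peirce i j \<Longrightarrow> y \<in> peirce j k \<Longrightarrow> x * y \<in> peirce i k"
  by (simp add: peirce_def mult.assoc) (simp add: mult.assoc[symmetric])

lemma peirce_mult_zero: "x \<in> peirce i j \<Longrightarrow> y \<in> peirce k l \<Longrightarrow> j \<noteq> k \<Longrightarrow> x * y = 0"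
  using peirce_right[of x i j j] peirce_left[of y k l j] mult.assoc[of x "e j" y] by simp

lemma component_peirce:
  "x \<in> peirce i j \<Longrightarrow> e k * x * e l = (if k = i \<and> l = j then x else 0)"
  by (simp add: peirce_left peirce_right)

text \<open>
  This is how fullness of \<open>e k\<close> enters: \<open>A e\<^sub>k A = A\<close> gives \<open>e\<^sub>i A e\<^sub>j = (e\<^sub>i A e\<^sub>k)(e\<^sub>k A e\<^sub>j)\<close>, so a property
  that is stable under differences may be checked on products through any chosen index \<open>k\<close>.
\<close>
lemma peirce_mult_induct [consumes 1, case_names mult diff]:
  assumes x: "x \<in> peirce i j"
    and base: "\<And>a b. a \<in> peirce i k \<Longrightarrow> b \<in> peirce k j \<Longrightarrow> Q (a * b)"
    and diff: "\<And>a b. a \<in> peirce i j \<Longrightarrow> b \<in> peirce i j \<Longrightarrow> Q a \<Longrightarrow> Q b \<Longrightarrow> Q (a - b)"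
  shows "Q x"
proof -
  have Q0: "Q 0"
    using base[of 0 0] by simp
  have "y \<in> group_closure {a * e k * b | a b. True} \<Longrightarrow> Q (e i * y * e j)" for y
  proof (induction rule: group_closure.induct)
    case (base s)
    then consider "s = 0" | a b where "s = a * e k * b"
      by auto
    then show ?case
    proof cases
      case 1
      then show ?thesis by (simp add: Q0)
    next
      case 2
      then have "e i * s * e j = (e i * a * e k) * (e k * b * e j)"
        by (simp add: mult.assoc e_mult_left)
      then show ?thesis
        using assms(2)[of "e i * a * e k" "e k * b * e j"] by simp
    qed
  next
    case (diff s t)
    have "e i * (s - t) * e j = e i * s * e j - e i * t * e j"
      by (simp add: algebra_simps)
    then show ?case
      using diff assms(3) by simp
  qed
  moreover have "x \<in> group_closure {a * e k * b | a b. True}"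
    using full[of k] by (simp add: full_idempotent_def)
  ultimately have "Q (e i * x * e j)"
    by blast
  then show ?thesis
    using component_peirce[OF x, of i j] by simp
qed

text \<open>
  The off-diagonal components generate \<open>A\<close> as a ring, because a diagonal component
  \<open>e\<^sub>i A e\<^sub>i\<close> is spanned by the products from \<open>(e\<^sub>i A e\<^sub>k)(e\<^sub>k A e\<^sub>i)\<close> with \<open>k \<noteq> i\<close>.
\<close>
lemma generate_induct [case_names peirce diff mult]:
  assumes base: "\<And>i j x. i \<noteq> j \<Longrightarrow> x \<in> peirce i j \<Longrightarrow> Q x"
    and diff: "\<And>x y. Q x \<Longrightarrow> Q y \<Longrightarrow> Q (x - y)"
    and mult: "\<And>x y. Q x \<Longrightarrow> Q y \<Longrightarrow> Q (x * y)"
  shows "Q x"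
proof -
  have comp: "Q (e i * x * e j)" for i j
  proof (cases "i = j")
    case False
    then show ?thesis using base[of i j] by simp
  next
    case True
    obtain k where k: "k \<noteq> i"
      using ex_third by blast
    have "e i * x * e i \<in> peirce i i"
      by simp
    then show ?thesis
      unfolding \<open>i = j\<close>[symmetric]
    proof (induction rule: peirce_mult_induct[where k = k])
      case (mult a b)
      show ?case
        using assms(3)[of a b] base[OF k(1)[symmetric] mult(1)] base[OF k(1) mult(2)] by blast
    next
      case (diff a b)
      then show ?case
        using assms(2) by blast
    qed
  qed
  have Q0: "Q 0"
    using base[of One Two] by simp
  have add: "Q (x + y)" if "Q x" "Q y" for x y
    using diff[of x "0 - y"] diff[of 0 y] Q0 that by simp
  have "Q (\<Sum>i\<in>UNIV. \<Sum>j\<in>UNIV. e i * x * e j)"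
    by (simp add: UNIV_three add comp)
  then show ?thesis
    using peirce_decomposition[of x] by simp
qed

text \<open>
  The component \<open>A\<^sub>i\<^sub>j\<close> is faithful, since \<open>e\<^sub>i\<close> is a sum of products from \<open>A\<^sub>i\<^sub>j A\<^sub>j\<^sub>i\<close>. This lemma and the next
  detect vanishing of Peirce components.
\<close>
lemma annihilator_right:
  assumes "\<And>x. x \<in> peirce i j \<Longrightarrow> z * x = 0"
  shows "z * e i = 0"
proof -
  have "e i \<in> peirce i i" by (simp add: peirce_def idem)
  then show ?thesis
    by (induction rule: peirce_mult_induct[where k = j])
      (simp_all add: assms mult.assoc[symmetric] right_diff_distrib)
qed

lemma annihilator_left:
  assumes "\<And>x. x \<in> peirce i j \<Longrightarrow> x * z = 0"
  shows "e j * z = 0"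
proof -
  have "e j \<in> peirce j j" by (simp add: peirce_def idem)
  then show ?thesis
    by (induction rule: peirce_mult_induct[where k = i])
      (simp_all add: assms mult.assoc left_diff_distrib)
qed

text \<open>
  Multiplying \<open>zx = xz\<close> by \<open>e\<^sub>k\<close> on the left kills \<open>xz\<close>, and on the right by \<open>e\<^sub>l\<close> kills \<open>zx\<close>; faithfulness
  of \<open>A\<^sub>i\<^sub>j\<close> does the rest.
\<close>
lemma centralizer_components:
  assumes comm: "\<forall>x\<in>peirce i j. z * x = x * z"
  shows "k \<noteq> i \<Longrightarrow> e k * z * e i = 0"
    and "l \<noteq> j \<Longrightarrow> e j * z * e l = 0"
proof -
  assume k: "k \<noteq> i"
  show "e k * z * e i = 0"
  proof (rule annihilator_right)
    fix x assume x: "x \<in> peirce i j"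
    have "e k * z * x = (e k * x) * z"
      by (simp add: mult.assoc bspec[OF comm x])
    then show "e k * z * x = 0"
      using k x by (simp add: peirce_left)
  qed
next
  assume l: "l \<noteq> j"
  have "e j * (z * e l) = 0"
  proof (rule annihilator_left)
    fix x assume x: "x \<in> peirce i j"
    have "x * (z * e l) = z * (x * e l)"
      by (simp add: mult.assoc[symmetric] bspec[OF comm x])
    then show "x * (z * e l) = 0"
      using l x by (simp add: peirce_right)
  qed
  then show "e j * z * e l = 0"
    by (simp add: mult.assoc)
qed

lemma off_diagonal_mem: "i \<noteq> j \<Longrightarrow> x \<in> peirce i j \<Longrightarrow> x \<in> commutator_subgroup"
  using commutator_mem[of "e i" x] by (simp add: peirce_left peirce_right)

text \<open>
  The identity \<open>[ab,s] = [a,bs] + [b,sa]\<close> reduces a bracket with a product to brackets with its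
  factors, so only brackets of an off-diagonal element with a Peirce component remain; all of these
  are off-diagonal except those between \<open>A\<^sub>i\<^sub>j\<close> and \<open>A\<^sub>j\<^sub>i\<close>.
\<close>
lemma commutator_induct [consumes 1, case_names off_diagonal diff bracket]:
  assumes x: "x \<in> commutator_subgroup"
    and base: "\<And>i j x. i \<noteq> j \<Longrightarrow> x \<in> peirce i j \<Longrightarrow> Q x"
    and diff: "\<And>x y. x \<in> commutator_subgroup \<Longrightarrow> y \<in> commutator_subgroup \<Longrightarrow> Q x \<Longrightarrow> Q y \<Longrightarrow> Q (x - y)"
    and bracket: "\<And>i j x y. i \<noteq> j \<Longrightarrow> x \<in> peirce i j \<Longrightarrow> y \<in> peirce j i \<Longrightarrow> Q (x * y - y * x)"
  shows "Q x"
proof -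
  have Q0: "Q 0"
    using base[of One Two] by simp
  have add: "Q (x + y)" if "x \<in> commutator_subgroup" "y \<in> commutator_subgroup" "Q x" "Q y" for x y
    using diff[of x "0 - y"] diff[of 0 y] Q0 that commutator_diff[of 0 y] by simp
  have *: "Q (r * s - s * r)" for r s
  proof -
    have "\<forall>s. Q (r * s - s * r)"
    proof (induction r rule: generate_induct)
      case (peirce i j g)
      show ?case
      proof
        fix s
        have comp: "Q (g * (e k * s * e l) - (e k * s * e l) * g)" for k l
        proof (cases "k = j \<and> l = i")
          case True
          then show ?thesis using bracket[OF peirce, of "e k * s * e l"] by simp
        next
          case False
          have gl: "g * (e k * s * e l) = 0 \<or> k = j \<and> g * (e k * s * e l) \<in> peirce i l"
            and gr: "(e k * s * e l) * g = 0 \<or> l = i \<and> (e k * s * e l) * g \<in> peirce k j"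
            using peirce_mult_zero[OF peirce(2) peirce_component[of k s l]]
              peirce_mult_zero[OF peirce_component[of k s l] peirce(2)]
              peirce_mult[OF peirce(2), of "e k * s * e l" l]
              peirce_mult[OF _ peirce(2), of "e k * s * e l" k]
              peirce_component[of k s l] by blast+
          have "Q (g * (e k * s * e l))"
            using gl base[of i l] Q0 False by auto
          moreover have "Q ((e k * s * e l) * g)"
            using gr base[of k j] Q0 False by auto
          moreover have "g * (e k * s * e l) \<in> commutator_subgroup" "(e k * s * e l) * g \<in> commutator_subgroup"
            using gl gr False off_diagonal_mem[of i l] off_diagonal_mem[of k j] by auto
          ultimately show ?thesis
            using diff by blast
        qed
        have "Q (\<Sum>k\<in>UNIV. \<Sum>l\<in>UNIV. g * (e k * s * e l) - (e k * s * e l) * g)"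
          unfolding UNIV_three by (simp add: add comp commutator_mem commutator_add)
        moreover have "(\<Sum>k\<in>UNIV. \<Sum>l\<in>UNIV. g * (e k * s * e l) - (e k * s * e l) * g)
            = g * (\<Sum>k\<in>UNIV. \<Sum>l\<in>UNIV. e k * s * e l) - (\<Sum>k\<in>UNIV. \<Sum>l\<in>UNIV. e k * s * e l) * g"
          by (simp add: sum_subtractf sum_distrib_left sum_distrib_right)
        ultimately show "Q (g * s - s * g)"
          using peirce_decomposition[of s] by simp
      qed
    next
      case (diff x y)
      have "(x - y) * s - s * (x - y) = (x * s - s * x) - (y * s - s * y)" for s
        by (simp add: algebra_simps)
      moreover have "Q ((x * s - s * x) - (y * s - s * y))" for s
        using diff by (intro assms(3)[OF commutator_mem commutator_mem]) simp_all
      ultimately show ?case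
        by simp
    next
      case (mult x y)
      have "x * y * s - s * (x * y) = (x * (y * s) - (y * s) * x) + (y * (s * x) - (s * x) * y)" for s
        by (simp add: algebra_simps)
      then show ?case
        using mult add commutator_mem by metis
    qed
    then show ?thesis by blast
  qed
  show ?thesis
    using x unfolding commutator_subgroup_def
  proof (induction rule: group_closure.induct)
    case (base s)
    then show ?case
      using * Q0 by (auto simp: lie_bracket_def)
  next
    case (diff s t)
    then show ?case
      using assms(3) unfolding commutator_subgroup_def by blast
  qed
qed

section \<open>Extending multiplicative maps from the off-diagonal components\<close>

text \<open>
  The value at \<open>ay\<close> is forced; what has to be shown is that it depends on the element \<open>ay\<close> only, and
  not on the factors or on \<open>j\<close>. Writing \<open>e\<^sub>i = \<Sum> c d\<close> with \<open>c\<close> in \<open>A\<^sub>i\<^sub>n\<close> and \<open>d\<close> in \<open>A\<^sub>n\<^sub>i\<close>, the formula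
  \<open>T(r) = \<Sum> \<theta>(c)\<theta>(dr)\<close> is additive in \<open>r\<close> by construction and has the required values. To avoid
  choosing such a sum, the proof shows by induction over \<open>s\<close> in \<open>A\<^sub>i\<^sub>i\<close> that there is a \<open>T\<close> with the
  required values for the maps \<open>a \<mapsto> \<theta>(sa)\<close>, and takes \<open>s = e\<^sub>i\<close>.
  
  The multiplication of the target is a parameter \<open>m\<close>, so that the opposite multiplication covers
  antihomomorphisms.
\<close>
lemma diagonal_extension:
  fixes m :: "'b::ab_group_add \<Rightarrow> 'b \<Rightarrow> 'b" and \<theta> :: "three \<Rightarrow> three \<Rightarrow> 'a \<Rightarrow> 'b"
  assumes addl: "\<And>t. additive (\<lambda>s. m s t)" and addr: "\<And>s. additive (m s)"
    and assoc: "\<And>s t u. m (m s t) u = m s (m t u)"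
    and \<theta>_add: "\<And>i j. additive (\<theta> i j)"
    and adjacent: "\<And>i j k a b. i \<noteq> j \<Longrightarrow> j \<noteq> k \<Longrightarrow> i \<noteq> k \<Longrightarrow> a \<in> peirce i j \<Longrightarrow> b \<in> peirce j k
      \<Longrightarrow> m (\<theta> i j a) (\<theta> j k b) = \<theta> i k (a * b)"
  shows "\<exists>T. additive T \<and> (\<forall>j a y. j \<noteq> i \<longrightarrow> a \<in> peirce i j \<longrightarrow> y \<in> peirce j i
    \<longrightarrow> T (a * y) = m (\<theta> i j a) (\<theta> j i y))"
proof -
  interpret addl: additive "\<lambda>s. m s t" for t by (rule addl)
  interpret addr: additive "m s" for s by (rule addr)
  interpret \<theta>: additive "\<theta> p q" for p q by (rule \<theta>_add)
  define Q where "Q s \<longleftrightarrow> (\<exists>T. additive T \<and> (\<forall>j a y. j \<noteq> i \<longrightarrow> a \<in> peirce i j \<longrightarrow> y \<in> peirce j i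
    \<longrightarrow> T (a * y) = m (\<theta> i j (s * a)) (\<theta> j i y)))" for s
  obtain n where n: "n \<noteq> i"
    using ex_third by blast
  have "e i \<in> peirce i i" by (simp add: peirce_def idem)
  then have "Q (e i)"
  proof (induction rule: peirce_mult_induct[where k = n])
    case (mult c d)
    have "m (\<theta> i n c) (\<theta> n i (d * (a * y))) = m (\<theta> i j (c * d * a)) (\<theta> j i y)"
      if j: "j \<noteq> i" and a: "a \<in> peirce i j" and y: "y \<in> peirce j i" for j a y
      \<comment> \<open>If \<open>j\<close> is the index used for \<open>c\<close> and \<open>d\<close>, then \<open>da\<close> is diagonal, and \<open>a\<close> has to be factored
        through the third index first.\<close>
    proof (cases "j = n")
      case False
      have "m (\<theta> i n c) (\<theta> n i (d * (a * y))) = m (\<theta> i n c) (m (\<theta> n j (d * a)) (\<theta> j i y))"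
        using adjacent[of n j i "d * a" y] False n j a y mult peirce_mult
        by (simp add: mult.assoc)
      also have "\<dots> = m (\<theta> i j (c * d * a)) (\<theta> j i y)"
        using adjacent[of i n j c "d * a"] False n j a y mult(1) peirce_mult[OF mult(2) a]
        by (simp add: assoc[symmetric] mult.assoc)
      finally show ?thesis .
    next
      case True
      obtain k where k: "k \<noteq> i" "k \<noteq> n"
        using ex_third by blast
      have d: "d \<in> peirce n i" and c: "c \<in> peirce i n" and y': "y \<in> peirce n i"
        using mult y True by auto
      have "a \<in> peirce i n" using a True by simp
      then have "m (\<theta> i n c) (\<theta> n i (d * (a * y))) = m (\<theta> i n (c * d * a)) (\<theta> n i y)"
      proof (induction rule: peirce_mult_induct[where k = k])
        case (mult b q)
        have db: "d * b \<in> peirce n k" and qy: "q * y \<in> peirce k i"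
          using mult d y' peirce_mult by blast+
        have cdb: "c * (d * b) \<in> peirce i k"
          using c db peirce_mult by blast
        have "m (\<theta> i n c) (\<theta> n i (d * (b * q * y)))
          = m (\<theta> i n c) (m (\<theta> n k (d * b)) (m (\<theta> k n q) (\<theta> n i y)))"
          using adjacent[of n k i "d * b" "q * y"] adjacent[of k n i q y] n k db qy mult y'
          by (simp add: mult.assoc)
        also have "\<dots> = m (m (m (\<theta> i n c) (\<theta> n k (d * b))) (\<theta> k n q)) (\<theta> n i y)"
          by (simp add: assoc)
        also have "\<dots> = m (\<theta> i n (c * d * (b * q))) (\<theta> n i y)"
          using adjacent[of i n k c "d * b"] adjacent[of i k n "c * (d * b)" q] n k db c cdb mult
          by (simp add: mult.assoc)
        finally show ?case .
      next
        case (diff a b)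
        then show ?case
          by (simp add: algebra_simps \<theta>.diff addr.diff addl.diff)
      qed
      then show ?thesis using True by simp
    qed
    moreover have "additive (\<lambda>r. m (\<theta> i n c) (\<theta> n i (d * r)))"
      by standard (simp add: algebra_simps \<theta>.add addr.add)
    ultimately show ?case
      unfolding Q_def
      by (intro exI[where x = "\<lambda>r. m (\<theta> i n c) (\<theta> n i (d * r))"]) auto
  next
    case (diff s t)
    then obtain S T where S: "additive S" "\<And>j a y. j \<noteq> i \<Longrightarrow> a \<in> peirce i j \<Longrightarrow> y \<in> peirce j i
        \<Longrightarrow> S (a * y) = m (\<theta> i j (s * a)) (\<theta> j i y)"
      and T: "additive T" "\<And>j a y. j \<noteq> i \<Longrightarrow> a \<in> peirce i j \<Longrightarrow> y \<in> peirce j i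
        \<Longrightarrow> T (a * y) = m (\<theta> i j (t * a)) (\<theta> j i y)"
      unfolding Q_def by metis
    have "additive (\<lambda>r. S r - T r)"
      using S(1) T(1) by (simp add: additive_def algebra_simps)
    then show ?case
      unfolding Q_def
      by (intro exI[where x = "\<lambda>r. S r - T r"])
        (auto simp: S(2) T(2) algebra_simps \<theta>.diff addl.diff)
  qed
  then obtain T where "additive T"
    and T: "\<forall>j a y. j \<noteq> i \<longrightarrow> a \<in> peirce i j \<longrightarrow> y \<in> peirce j i
      \<longrightarrow> T (a * y) = m (\<theta> i j (e i * a)) (\<theta> j i y)"
    unfolding Q_def by blast
  have "T (a * y) = m (\<theta> i j a) (\<theta> j i y)"
    if "j \<noteq> i" "a \<in> peirce i j" "y \<in> peirce j i" for j a y
    using T that peirce_left[OF that(2), of i] by simp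
  with \<open>additive T\<close> show ?thesis
    by blast
qed

text \<open>
  Take \<open>\<theta>\<close> off the diagonal and the maps of the previous lemma on the diagonal, and sum over all
  components. It suffices to check multiplicativity for a left factor from an off-diagonal component,
  because these generate the ring and the admissible left factors are closed under products.
\<close>
lemma multiplicative_extension:
  fixes m :: "'b::ab_group_add \<Rightarrow> 'b \<Rightarrow> 'b" and \<theta> :: "three \<Rightarrow> three \<Rightarrow> 'a \<Rightarrow> 'b"
  assumes addl: "\<And>t. additive (\<lambda>s. m s t)" and addr: "\<And>s. additive (m s)"
    and assoc: "\<And>s t u. m (m s t) u = m s (m t u)"
    and \<theta>_add: "\<And>i j. additive (\<theta> i j)"
    and adjacent: "\<And>i j k a b. i \<noteq> j \<Longrightarrow> j \<noteq> k \<Longrightarrow> i \<noteq> k \<Longrightarrow> a \<in> peirce i j \<Longrightarrow> b \<in> peirce j k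
      \<Longrightarrow> m (\<theta> i j a) (\<theta> j k b) = \<theta> i k (a * b)"
    and mismatch: "\<And>i j k l a b. i \<noteq> j \<Longrightarrow> k \<noteq> l \<Longrightarrow> j \<noteq> k \<Longrightarrow> a \<in> peirce i j \<Longrightarrow> b \<in> peirce k l
      \<Longrightarrow> m (\<theta> i j a) (\<theta> k l b) = 0"
  obtains \<psi> where "additive \<psi>" "\<And>x y. \<psi> (x * y) = m (\<psi> x) (\<psi> y)"
    "\<And>i j x. i \<noteq> j \<Longrightarrow> x \<in> peirce i j \<Longrightarrow> \<psi> x = \<theta> i j x"
proof -
  interpret addl: additive "\<lambda>s. m s t" for t by (rule addl)
  interpret addr: additive "m s" for s by (rule addr)
  interpret \<theta>: additive "\<theta> p q" for p q by (rule \<theta>_add)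
  have "\<forall>i. \<exists>T. additive T \<and> (\<forall>j a y. j \<noteq> i \<longrightarrow> a \<in> peirce i j \<longrightarrow> y \<in> peirce j i
    \<longrightarrow> T (a * y) = m (\<theta> i j a) (\<theta> j i y))"
    by (intro allI diagonal_extension addl addr assoc \<theta>_add adjacent)
  from choice[OF this]
  obtain T where T_add: "\<And>i. additive (T i)"
    and T: "\<And>i j a y. j \<noteq> i \<Longrightarrow> a \<in> peirce i j \<Longrightarrow> y \<in> peirce j i
      \<Longrightarrow> T i (a * y) = m (\<theta> i j a) (\<theta> j i y)"
    by blast
  interpret T: additive "T i" for i by (rule T_add)
  define \<eta> where "\<eta> i j = (if i = j then T i else \<theta> i j)" for i j
  have \<eta>_add: "additive (\<eta> i j)" for i j
    by (simp add: \<eta>_def T_add \<theta>_add)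
  interpret \<eta>: additive "\<eta> p q" for p q by (rule \<eta>_add)
  define \<psi> where "\<psi> r = (\<Sum>i\<in>UNIV. \<Sum>j\<in>UNIV. \<eta> i j (e i * r * e j))" for r
  have \<psi>_add: "additive \<psi>"
    by standard (simp add: \<psi>_def algebra_simps \<eta>.add sum.distrib)
  interpret \<psi>: additive \<psi> by (rule \<psi>_add)
  have \<psi>_peirce: "\<psi> x = \<eta> i j x" if "x \<in> peirce i j" for x i j
    using that unfolding \<psi>_def
    by (cases i; cases j) (simp_all add: UNIV_three component_peirce \<eta>.zero)
  have \<psi>_off: "\<psi> x = \<theta> i j x" if "i \<noteq> j" "x \<in> peirce i j" for x i j
    using that by (simp add: \<psi>_peirce \<eta>_def)
  have \<psi>_diag: "\<psi> (a * y) = m (\<theta> i j a) (\<theta> j i y)"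
    if "j \<noteq> i" "a \<in> peirce i j" "y \<in> peirce j i" for i j a y
    using \<psi>_peirce[OF peirce_mult[OF that(2,3)]] that by (simp add: \<eta>_def T)
  have off_mult: "\<psi> (g * r) = m (\<theta> i j g) (\<psi> r)"
    if ij: "i \<noteq> j" and g: "g \<in> peirce i j" and r: "r \<in> peirce k l" for i j k l g r
  proof (cases "k = l")
    case False
    show ?thesis
    proof (cases "j = k")
      case True
      then show ?thesis
        using adjacent[of i j l g r] \<psi>_off[of i l "g * r"] \<psi>_off[of k l r] \<psi>_diag[of j i g r]
          False ij g r peirce_mult[of g i j r l]
        by (cases "i = l") auto
    next
      case jk: False
      then show ?thesis
        using mismatch[OF ij False jk g r] peirce_mult_zero[OF g r jk] \<psi>_off[OF False r]
        by (simp add: \<psi>.zero)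
    qed
  next
    case True
    obtain n where n: "n \<noteq> i" "n \<noteq> j"
      using ex_third by blast
    \<comment> \<open>The diagonal element \<open>r\<close> is factored through an index \<open>p\<close> with \<open>p \<noteq> i\<close> when \<open>j = k\<close>, so that
      \<open>ga\<close> stays off the diagonal.\<close>
    obtain p where p: "p \<noteq> k" "j = k \<longrightarrow> p = n"
      using ex_third[of k k] n by auto
    have "r \<in> peirce k k" using r True by simp
    then show ?thesis
    proof (induction rule: peirce_mult_induct[where k = p])
      case (mult a b)
      have \<psi>ab: "\<psi> (a * b) = m (\<theta> k p a) (\<theta> p k b)"
        using \<psi>_diag mult p by blast
      show ?case
      proof (cases "j = k")
        case True
        have "g * a \<in> peirce i n"
          using peirce_mult g mult p True by blast
        then show ?thesis
          using True p n ij mult \<psi>ab adjacent[of i k p g a] adjacent[of i p k "g * a" b] g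
            \<psi>_off[of i k "g * (a * b)"] peirce_mult[of g i j "a * b" k] peirce_mult[of a k p b k]
          by (simp add: assoc[symmetric] mult.assoc)
      next
        case False
        have "g * (a * b) = 0"
          using peirce_mult_zero[OF g mult(1) False] by (simp add: mult.assoc[symmetric])
        then show ?thesis
          using mismatch[of i j k p g a] False p ij g mult
          by (simp add: \<psi>ab assoc[symmetric] \<psi>.zero addl.zero)
      qed
    next
      case (diff a b)
      then show ?case
        by (simp add: algebra_simps \<psi>.diff addr.diff)
    qed
  qed
  have off_mult': "\<psi> (g * s) = m (\<psi> g) (\<psi> s)" if ij: "i \<noteq> j" and g: "g \<in> peirce i j" for i j g s
  proof -
    have "\<psi> (g * (\<Sum>k\<in>UNIV. \<Sum>l\<in>UNIV. e k * s * e l))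
      = m (\<theta> i j g) (\<psi> (\<Sum>k\<in>UNIV. \<Sum>l\<in>UNIV. e k * s * e l))"
      by (simp add: UNIV_three distrib_left \<psi>.add addr.add off_mult[OF ij g peirce_component])
    then show ?thesis
      using peirce_decomposition[of s] \<psi>_off[OF ij g] by simp
  qed
  have "\<forall>s. \<psi> (r * s) = m (\<psi> r) (\<psi> s)" for r
  proof (induction r rule: generate_induct)
    case (peirce i j x)
    then show ?case using off_mult' by blast
  next
    case (diff x y)
    then show ?case by (simp add: algebra_simps \<psi>.diff addl.diff)
  next
    case (mult x y)
    then show ?case by (simp add: mult.assoc assoc)
  qed
  then show ?thesis
    using that \<psi>_add \<psi>_off by blast
qed

end

section \<open>Lie isomorphisms onto the commutators of another ring\<close>

text \<open>
  Left multiplication by \<open>a\<close> maps a commutator with \<open>b\<close> to a commutator with \<open>b\<close>. This is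
  how associative products in \<open>B\<close> are recognized as elements of \<open>[B,B]\<close>.
\<close>
lemma commuting_factor_absorbed:
  fixes a b t :: "'r::ring"
  assumes "a * b = b * a"
  shows "a * (t * b - b * t) = (a * t) * b - b * (a * t)"
  using assms by (simp add: right_diff_distrib mult.assoc[symmetric])

locale lie_iso_frame = peirce_frame e
  for e :: "three \<Rightarrow> 'a::{ring, monoid_mult}" +
  fixes \<phi> :: "'a \<Rightarrow> 'b::ring"
  assumes iso: "lie_ring_iso_on commutator_subgroup commutator_subgroup \<phi>"
begin

abbreviation L :: "'a set"
  where "L \<equiv> commutator_subgroup"

abbreviation M :: "'b set"
  where "M \<equiv> commutator_subgroup"

lemma phi_add: "x \<in> L \<Longrightarrow> y \<in> L \<Longrightarrow> \<phi> (x + y) = \<phi> x + \<phi> y"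
  using iso by (simp add: lie_ring_iso_on_def)

lemma phi_zero: "\<phi> 0 = 0"
  using phi_add[of 0 0] by simp

lemma phi_diff: "x \<in> L \<Longrightarrow> y \<in> L \<Longrightarrow> \<phi> (x - y) = \<phi> x - \<phi> y"
  using phi_add[of "x - y" y] commutator_diff[of x y] by simp

lemma phi_inj: "x \<in> L \<Longrightarrow> y \<in> L \<Longrightarrow> \<phi> x = \<phi> y \<Longrightarrow> x = y"
  using iso by (auto simp: lie_ring_iso_on_def bij_betw_def inj_on_def)

lemma phi_surj:
  assumes "t \<in> M"
  obtains z where "z \<in> L" "\<phi> z = t"
proof -
  have "\<phi> ` L = M"
    using iso by (simp add: lie_ring_iso_on_def bij_betw_def)
  with assms have "t \<in> \<phi> ` L"
    by simp
  then obtain z where "z \<in> L" "\<phi> z = t"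
    by (rule imageE) simp
  then show ?thesis
    by (rule that)
qed

lemma phi_bracket: "x \<in> L \<Longrightarrow> y \<in> L \<Longrightarrow> \<phi> (x * y - y * x) = \<phi> x * \<phi> y - \<phi> y * \<phi> x"
  using iso by (simp add: lie_ring_iso_on_def lie_bracket_def)

lemma phi_commute_reflects:
  assumes "x \<in> L" "y \<in> L" "\<phi> x * \<phi> y = \<phi> y * \<phi> x"
  shows "x * y = y * x"
  using phi_inj[of "x * y - y * x" 0] phi_bracket[OF assms(1,2)] assms(3)
  by (simp add: commutator_mem phi_zero)

lemma phi_off_diff:
  "i \<noteq> j \<Longrightarrow> x \<in> peirce i j \<Longrightarrow> y \<in> peirce i j \<Longrightarrow> \<phi> (x - y) = \<phi> x - \<phi> y"
  by (simp add: phi_diff off_diagonal_mem)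

lemma phi_adjacent:
  assumes "i \<noteq> j" "j \<noteq> k" "i \<noteq> k" "a \<in> peirce i j" "b \<in> peirce j k"
  shows "\<phi> (a * b) = \<phi> a * \<phi> b - \<phi> b * \<phi> a"
  using phi_bracket[of a b] off_diagonal_mem peirce_mult_zero[of b j k a i j] assms by simp

lemma phi_commute:
  assumes "i \<noteq> j" "k \<noteq> l" "j \<noteq> k" "l \<noteq> i" "a \<in> peirce i j" "b \<in> peirce k l"
  shows "\<phi> a * \<phi> b = \<phi> b * \<phi> a"
  using phi_bracket[of a b] off_diagonal_mem peirce_mult_zero[of a i j b k l]
    peirce_mult_zero[of b k l a i j] assms by (simp add: phi_zero)

section \<open>Products of images of off-diagonal elements\<close>

text \<open>
  Write \<open>p\<close> as a sum of products \<open>yb = [y,b]\<close> with \<open>y\<close> in \<open>A\<^sub>j\<^sub>i\<close> and \<open>b\<close> in \<open>A\<^sub>i\<^sub>k\<close>. The images of \<open>a\<close> and \<open>b\<close>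
  commute, so \<open>\<phi>(a)[\<phi>(y),\<phi>(b)]\<close> is a commutator.
\<close>
lemma adjacent_product_mem:
  assumes d: "i \<noteq> j" "j \<noteq> k" "i \<noteq> k" and a: "a \<in> peirce i j" and p: "p \<in> peirce j k"
  shows "\<phi> a * \<phi> p \<in> M"
  using p
proof (induction rule: peirce_mult_induct[where k = i])
  case (mult y b)
  have "\<phi> (y * b) = \<phi> y * \<phi> b - \<phi> b * \<phi> y"
    using phi_adjacent[of j i k y b] d mult by blast
  moreover have "\<phi> a * \<phi> b = \<phi> b * \<phi> a"
    using phi_commute[of i j i k a b] d a mult by blast
  ultimately show ?case
    using commuting_factor_absorbed[of "\<phi> a" "\<phi> b" "\<phi> y"]
      commutator_mem[of "\<phi> a * \<phi> y" "\<phi> b"] by simp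
next
  case (diff x y)
  then show ?case
    using phi_off_diff[OF d(2)] by (simp add: right_diff_distrib commutator_diff)
qed

text \<open>
  Both \<open>a\<close> and \<open>p\<close> commute with \<open>A\<^sub>i\<^sub>k\<close>. Hence so does \<open>z\<close>, because this can be tested after applying
  \<open>\<phi>\<close>, and the three components vanish.
\<close>
lemma adjacent_product_lift:
  assumes d: "i \<noteq> j" "j \<noteq> k" "i \<noteq> k" and a: "a \<in> peirce i j" and p: "p \<in> peirce j k"
  obtains z where "z \<in> L" "\<phi> z = \<phi> a * \<phi> p"
    "e j * z * e i = 0" "e k * z * e i = 0" "e k * z * e j = 0"
proof -
  obtain z where z: "z \<in> L" "\<phi> z = \<phi> a * \<phi> p"
    using phi_surj adjacent_product_mem[OF assms] by metis
  have comm: "\<forall>x\<in>peirce i k. z * x = x * z"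
  proof (intro ballI phi_commute_reflects)
    fix x assume x: "x \<in> peirce i k"
    have "\<phi> a * \<phi> x = \<phi> x * \<phi> a" "\<phi> p * \<phi> x = \<phi> x * \<phi> p"
      using phi_commute[of i j i k a x] phi_commute[of j k i k p x] d a p x by auto
    then show "\<phi> z * \<phi> x = \<phi> x * \<phi> z"
      using z(2) by (metis mult.assoc)
  qed (use z d off_diagonal_mem in auto)
  show ?thesis
  proof (rule that[OF z])
    show "e j * z * e i = 0" "e k * z * e i = 0"
      using centralizer_components(1)[OF comm] d by metis+
    show "e k * z * e j = 0"
      using centralizer_components(2)[OF comm] d by metis
  qed
qed

text \<open>
  For \<open>b = cp\<close> with \<open>c\<close> in \<open>A\<^sub>i\<^sub>j\<close> and \<open>p\<close> in \<open>A\<^sub>j\<^sub>k\<close> the product is \<open>[\<phi>(c), \<phi>(a)\<phi>(p)] = \<phi>[c,z]\<close>. In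
  \<open>[c,z]\<close> only the components in row \<open>i\<close> and off the diagonal survive; in particular no central term
  can appear.
\<close>
lemma row_product_lift:
  assumes d: "i \<noteq> j" "j \<noteq> k" "i \<noteq> k" and a: "a \<in> peirce i j" and b: "b \<in> peirce i k"
  shows "\<exists>w\<in>L. \<phi> w = \<phi> a * \<phi> b \<and> e i * w = w \<and> w * e i = 0"
  using b
proof (induction rule: peirce_mult_induct[where k = j])
  case (mult c p)
  obtain z where z: "z \<in> L" "\<phi> z = \<phi> a * \<phi> p"
    "e j * z * e i = 0" "e k * z * e i = 0" "e k * z * e j = 0"
    using adjacent_product_lift[OF d a mult(2)] .
  have c: "c \<in> L" using off_diagonal_mem[OF d(1)] mult by blast
  define w where "w = c * z - z * c"
  have "\<phi> w = \<phi> c * (\<phi> a * \<phi> p) - (\<phi> a * \<phi> p) * \<phi> c"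
    unfolding w_def using phi_bracket[OF c z(1)] z(2) by simp
  also have "\<dots> = \<phi> a * \<phi> (c * p)"
  proof -
    have "\<phi> a * \<phi> c = \<phi> c * \<phi> a"
      using phi_commute[of i j i j a c] d a mult by blast
    then show ?thesis
      using phi_adjacent[of i j k c p] d mult
      by (simp add: right_diff_distrib mult.assoc[symmetric])
  qed
  finally have \<phi>w: "\<phi> w = \<phi> a * \<phi> (c * p)" .
  have ei: "e i + e j + e k = 1"
    using sum_distinct d by blast
  have "z * e i = (e i + e j + e k) * z * e i"
    by (simp add: ei)
  then have zi: "z * e i = e i * z * e i"
    using z by (simp add: distrib_right)
  have "z * c = z * e i * c"
    using mult by (simp add: mult.assoc peirce_left)
  then have "e i * (z * c) = z * c"
    by (metis zi idem mult.assoc)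
  then have left: "e i * w = w"
    using mult by (simp add: w_def right_diff_distrib mult.assoc[symmetric] peirce_left)
  have "c * z * e i = (c * e j) * (z * e i)"
    using mult by (simp add: mult.assoc peirce_right)
  then have "c * z * e i = 0"
    using z(3) by (simp add: mult.assoc)
  then have right: "w * e i = 0"
    using mult d by (simp add: w_def left_diff_distrib mult.assoc peirce_right)
  show ?case
    using \<phi>w left right commutator_mem[of c z] unfolding w_def by blast
next
  case (diff x y)
  then obtain v w where "v \<in> L" "\<phi> v = \<phi> a * \<phi> x" "e i * v = v" "v * e i = 0"
    "w \<in> L" "\<phi> w = \<phi> a * \<phi> y" "e i * w = w" "w * e i = 0"
    by blast
  then show ?case
    using phi_off_diff[OF d(3)] diff(1,2)
    by (intro bexI[of _ "v - w"]) (auto simp: commutator_diff phi_diff right_diff_distrib left_diff_distrib)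
qed

text \<open>
  Bracketing \<open>\<phi>(a)\<phi>(b') = \<phi>(w)\<close> with \<open>\<phi>(p)\<close> turns the factor \<open>a\<close> into \<open>ap\<close> and \<open>w\<close> into \<open>wp\<close>, which
  lies in \<open>A\<^sub>i\<^sub>k\<close>.
\<close>
lemma root_space_product_lift:
  assumes ik: "i \<noteq> k" and b: "b \<in> peirce i k" "b' \<in> peirce i k"
  shows "\<exists>w\<in>peirce i k. \<phi> w = \<phi> b * \<phi> b'"
proof -
  obtain j where j: "j \<noteq> i" "j \<noteq> k"
    using ex_third by blast
  show ?thesis
    using b(1)
  proof (induction rule: peirce_mult_induct[where k = j])
    case (mult a p)
    obtain w where w: "w \<in> L" "\<phi> w = \<phi> a * \<phi> b'" "e i * w = w" "w * e i = 0"
      using row_product_lift[of i j k a b'] j ik mult b by blast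
    have "p * w = 0"
      using w(3) mult(2) ik peirce_right[of p j k i] by (metis mult.assoc mult_zero_left)
    then have "\<phi> (w * p) = \<phi> w * \<phi> p - \<phi> p * \<phi> w"
      using phi_bracket[of w p] w(1) off_diagonal_mem[OF j(2) mult(2)] by simp
    also have "\<dots> = \<phi> (a * p) * \<phi> b'"
      using phi_adjacent[of i j k a p] phi_commute[of j k i k p b'] j ik mult b
      by (simp add: w(2) left_diff_distrib mult.assoc)
    finally have "\<phi> (w * p) = \<phi> (a * p) * \<phi> b'" .
    moreover have "w * p \<in> peirce i k"
      using w(3) mult(2) by (simp add: peirce_def mult.assoc) (simp add: mult.assoc[symmetric])
    ultimately show ?case by blast
  next
    case (diff x y)
    then obtain v w where "v \<in> peirce i k" "\<phi> v = \<phi> x * \<phi> b'" "w \<in> peirce i k" "\<phi> w = \<phi> y * \<phi> b'"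
      by blast
    then show ?case
      using phi_off_diff[OF ik] diff(1,2)
      by (intro bexI[of _ "v - w"]) (auto simp: peirce_diff left_diff_distrib)
  qed
qed

text \<open>
  For \<open>x\<close> in \<open>A\<^sub>i\<^sub>j\<close> and \<open>y\<close> in \<open>A\<^sub>j\<^sub>i\<close> the bracket \<open>[x,y]\<close> acts on \<open>A\<^sub>i\<^sub>k\<close> as left multiplication by \<open>xy\<close>, and
  its image acts on products in \<open>B\<close> as a derivation. So \<open>\<phi>(rb)\<phi>(b') + \<phi>(b)\<phi>(rb') = \<phi>(rw)\<close> for all
  \<open>r\<close> in \<open>A\<^sub>i\<^sub>i\<close>, and \<open>r = e\<^sub>i\<close> gives \<open>2\<phi>(w) = \<phi>(w)\<close>.
\<close>
lemma root_space_product_zero: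
  assumes ik: "i \<noteq> k" and b: "b \<in> peirce i k" "b' \<in> peirce i k"
  shows "\<phi> b * \<phi> b' = 0"
proof -
  obtain j where j: "j \<noteq> i" "j \<noteq> k"
    using ex_third by blast
  obtain w where w: "w \<in> peirce i k" "\<phi> w = \<phi> b * \<phi> b'"
    using root_space_product_lift[OF assms] by blast
  have "e i \<in> peirce i i" by (simp add: peirce_def idem)
  then have "\<phi> (e i * b) * \<phi> b' + \<phi> b * \<phi> (e i * b') = \<phi> (e i * w)"
  proof (induction rule: peirce_mult_induct[where k = j])
    case (mult x y)
    define h where "h = x * y - y * x"
    have h: "h \<in> L"
      by (simp add: h_def commutator_mem)
    have act: "\<phi> (x * y * c) = \<phi> h * \<phi> c - \<phi> c * \<phi> h" if c: "c \<in> peirce i k" for c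
    proof -
      have "x * c = 0" "c * x = 0" "c * y = 0"
        using peirce_mult_zero c mult j ik by blast+
      then have "h * c - c * h = x * y * c"
        by (simp add: h_def left_diff_distrib right_diff_distrib mult.assoc)
          (simp add: mult.assoc[symmetric])
      then show ?thesis
        using phi_bracket[OF h, of c] off_diagonal_mem[OF ik c] by simp
    qed
    show ?case
      by (simp only: act b w(1)) (simp add: w(2) algebra_simps)
  next
    case (diff r s)
    have mem: "r * c \<in> L" "s * c \<in> L" if "c \<in> peirce i k" for c
      using diff(1,2) that off_diagonal_mem[OF ik] peirce_mult by blast+
    have "\<phi> ((r - s) * c) = \<phi> (r * c) - \<phi> (s * c)" if "c \<in> peirce i k" for c
      using phi_diff mem that by (simp add: left_diff_distrib)
    then show ?case
      using diff(3,4)[symmetric] b w(1) by (simp add: right_diff_distrib left_diff_distrib)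
  qed
  then show ?thesis
    using b w by (simp add: peirce_left)
qed

text \<open>
  The element \<open>w\<close> representing the product has components in \<open>A\<^sub>i\<^sub>j\<close> and \<open>A\<^sub>i\<^sub>k\<close> only. Brackets with
  \<open>A\<^sub>j\<^sub>k\<close> and \<open>A\<^sub>k\<^sub>j\<close> move them to products of two elements from the same component, which vanish.
\<close>
lemma row_product_zero:
  assumes ij: "i \<noteq> j" and ik: "i \<noteq> k" and a: "a \<in> peirce i j" and b: "b \<in> peirce i k"
  shows "\<phi> a * \<phi> b = 0"
proof (cases "j = k")
  case True
  then show ?thesis using root_space_product_zero ij a b by blast
next
  case jk: False
  obtain w where w: "w \<in> L" "\<phi> w = \<phi> a * \<phi> b" "e i * w = w" "w * e i = 0"
    using row_product_lift[OF ij jk ik a b] by blast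
  have "w * e j = 0"
  proof (rule annihilator_right)
    fix p assume p: "p \<in> peirce j k"
    have "p * w = 0"
      using w(3) p ik peirce_right[of p j k i] by (metis mult.assoc mult_zero_left)
    then have "\<phi> (w * p) = \<phi> w * \<phi> p - \<phi> p * \<phi> w"
      using phi_bracket[of w p] w(1) off_diagonal_mem[OF jk p] by simp
    also have "\<dots> = \<phi> (a * p) * \<phi> b"
      using phi_adjacent[of i j k a p] phi_commute[of j k i k p b] jk ij ik a b p
      by (simp add: w(2) left_diff_distrib mult.assoc)
    also have "\<dots> = 0"
      using root_space_product_zero ik peirce_mult[OF a p] b by blast
    finally show "w * p = 0"
      using phi_inj[of "w * p" 0] commutator_mem[of w p] \<open>p * w = 0\<close> by (simp add: phi_zero)
  qed
  moreover have "w * e k = 0"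
  proof (rule annihilator_right)
    fix q assume q: "q \<in> peirce k j"
    have "q * w = 0"
      using w(3) q ij peirce_right[of q k j i] by (metis mult.assoc mult_zero_left)
    then have "\<phi> (w * q) = \<phi> w * \<phi> q - \<phi> q * \<phi> w"
      using phi_bracket[of w q] w(1) off_diagonal_mem[OF _ q] jk by simp
    also have "\<dots> = \<phi> a * \<phi> (b * q)"
    proof -
      have "\<phi> q * \<phi> a = \<phi> a * \<phi> q"
        using phi_commute[of i j k j a q] jk ij ik a q by auto
      then show ?thesis
        using phi_adjacent[of i k j b q] jk ij ik b q
        by (simp add: w(2) right_diff_distrib mult.assoc[symmetric])
    qed
    also have "\<dots> = 0"
      using root_space_product_zero ij peirce_mult[OF b q] a by blast
    finally show "w * q = 0"
      using phi_inj[of "w * q" 0] commutator_mem[of w q] \<open>q * w = 0\<close> by (simp add: phi_zero)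
  qed
  ultimately have "w * (e i + e j + e k) = 0"
    using w(4) by (simp add: distrib_left)
  then show ?thesis
    using sum_distinct[OF ij ik jk] w(2) by (simp add: phi_zero)
qed

text \<open>
  The mirror image of the statement for rows. For \<open>b = ap'\<close> the product \<open>\<phi>(b)\<phi>(p)\<close> is the bracket of
  \<open>\<phi>(a)\<phi>(p) = \<phi>(z)\<close> with \<open>\<phi>(p')\<close>, so it is represented by \<open>w = [z,p']\<close>, whose only components lie
  in \<open>A\<^sub>i\<^sub>k\<close> and \<open>A\<^sub>j\<^sub>k\<close>; these are killed by brackets with \<open>A\<^sub>j\<^sub>i\<close> and \<open>A\<^sub>i\<^sub>j\<close>.
\<close>
lemma column_product_zero:
  assumes ik: "i \<noteq> k" and jk: "j \<noteq> k" and b: "b \<in> peirce i k" and p: "p \<in> peirce j k"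
  shows "\<phi> b * \<phi> p = 0"
proof (cases "i = j")
  case True
  then show ?thesis using root_space_product_zero ik b p by blast
next
  case ij: False
  show ?thesis
    using b
  proof (induction rule: peirce_mult_induct[where k = j])
    case (mult a p')
    have b: "a * p' \<in> peirce i k"
      using mult peirce_mult by blast
    obtain z where z: "z \<in> L" "\<phi> z = \<phi> a * \<phi> p"
      "e j * z * e i = 0" "e k * z * e i = 0" "e k * z * e j = 0"
      using adjacent_product_lift[OF ij jk ik mult(1) p] .
    have px: "\<phi> p * \<phi> x = \<phi> x * \<phi> p - \<phi> (x * p)" if "x \<in> peirce i j" for x
      using phi_adjacent[OF ij jk ik that p] by simp
    define w where "w = z * p' - p' * z"
    have w: "w \<in> L"
      by (simp add: w_def commutator_mem)
    have "\<phi> p * \<phi> p' = 0"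
      using root_space_product_zero[OF jk p mult(2)] .
    moreover have "\<phi> p' * \<phi> p = 0"
      using root_space_product_zero[OF jk mult(2) p] .
    moreover have "\<phi> w = \<phi> z * \<phi> p' - \<phi> p' * \<phi> z"
      using phi_bracket[OF z(1) off_diagonal_mem[OF jk mult(2)]] by (simp add: w_def)
    ultimately have \<phi>w: "\<phi> w = \<phi> (a * p') * \<phi> p"
      by (simp add: z(2) phi_adjacent[OF ij jk ik mult] left_diff_distrib mult.assoc)
    have ones: "e i + e j + e k = 1"
      using sum_distinct[OF ij ik jk] .
    have "p' * z = p' * e k * z * (e i + e j + e k)"
      using mult(2) ones by (simp add: peirce_right)
    also have "\<dots> = p' * (e k * z * e i) + p' * (e k * z * e j) + p' * (e k * z * e k)"
      by (simp add: distrib_left mult.assoc)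
    also have "\<dots> = p' * z * e k"
      using mult(2) by (simp add: z mult.assoc[symmetric] peirce_right)
    finally have w_right: "w * e k = w"
      using mult(2) by (simp add: w_def left_diff_distrib mult.assoc peirce_right idem)
    have "e k * z * p' = (e k * z * e j) * p'"
      using mult(2) by (simp add: mult.assoc peirce_left)
    then have w_k: "e k * w = 0"
      using mult(2) jk by (simp add: w_def right_diff_distrib mult.assoc[symmetric] peirce_left z)
    have w_mult: "w * x = 0" if "x \<in> peirce l m" "l \<noteq> k" for l m x
      using w_right peirce_left[OF that(1), of k] that(2) by (metis mult.assoc mult_zero_right)
    have w_j: "e j * w = 0"
    proof (rule annihilator_left)
      fix x assume x: "x \<in> peirce i j"
      have "\<phi> (x * w) = \<phi> x * (\<phi> (a * p') * \<phi> p) - \<phi> (a * p') * \<phi> p * \<phi> x"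
        using phi_bracket[OF off_diagonal_mem[OF ij x] w] w_mult[OF x ik] \<phi>w by simp
      also have "\<dots> = 0"
        using row_product_zero[OF ij ik x b] row_product_zero[OF ik ij b x]
          root_space_product_zero[OF ik b peirce_mult[OF x p]]
        by (simp add: mult.assoc px[OF x] right_diff_distrib) (simp add: mult.assoc[symmetric])
      finally show "x * w = 0"
        using phi_inj[of "x * w" 0] commutator_mem[of x w] w_mult[OF x ik] by (simp add: phi_zero)
    qed
    have w_i: "e i * w = 0"
    proof (rule annihilator_left)
      fix y assume y: "y \<in> peirce j i"
      have ji: "j \<noteq> i" using ij by simp
      have yb: "\<phi> y * \<phi> (a * p') = \<phi> (y * (a * p')) + \<phi> (a * p') * \<phi> y"
        using phi_adjacent[OF ji ik jk y b] by simp
      have "\<phi> (y * w) = \<phi> y * \<phi> (a * p') * \<phi> p - \<phi> (a * p') * (\<phi> p * \<phi> y)"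
        using phi_bracket[OF off_diagonal_mem[OF ji y] w] w_mult[OF y jk] \<phi>w
        by (simp add: mult.assoc)
      also have "\<dots> = 0"
        using row_product_zero[OF jk ji p y] row_product_zero[OF ji jk y p]
          root_space_product_zero[OF jk peirce_mult[OF y b] p]
        by (simp add: yb distrib_right) (simp add: mult.assoc)
      finally show "y * w = 0"
        using phi_inj[of "y * w" 0] commutator_mem[of y w] w_mult[OF y jk] by (simp add: phi_zero)
    qed
    have "(e i + e j + e k) * w = 0"
      by (simp add: distrib_right w_i w_j w_k)
    then show ?case
      using \<phi>w by (simp add: ones phi_zero)
  next
    case (diff x y)
    then show ?case
      using phi_off_diff[OF ik] by (simp add: left_diff_distrib)
  qed
qed

text \<open>
  By the relations for rows and columns \<open>z\<close> commutes with \<open>A\<^sub>i\<^sub>j\<close>, \<open>A\<^sub>j\<^sub>k\<close> and \<open>A\<^sub>i\<^sub>k\<close>. This leaves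
  only the component in \<open>A\<^sub>i\<^sub>k\<close> and the diagonal.
\<close>
lemma adjacent_product_components:
  assumes ij: "i \<noteq> j" and jk: "j \<noteq> k" and ik: "i \<noteq> k"
    and a: "a \<in> peirce i j" and p: "p \<in> peirce j k"
  shows "\<exists>z\<in>L. \<phi> z = \<phi> a * \<phi> p
    \<and> (\<forall>l m. l \<noteq> m \<longrightarrow> l \<noteq> i \<or> m \<noteq> k \<longrightarrow> e l * z * e m = 0)"
proof -
  obtain z where z: "z \<in> L" "\<phi> z = \<phi> a * \<phi> p"
    "e j * z * e i = 0" "e k * z * e i = 0" "e k * z * e j = 0"
    using adjacent_product_lift[OF ij jk ik a p] .
  have "\<forall>x\<in>peirce i j. z * x = x * z"
  proof (intro ballI phi_commute_reflects)
    fix x assume x: "x \<in> peirce i j"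
    have "\<phi> p * \<phi> x = \<phi> x * \<phi> p - \<phi> (x * p)"
      using phi_adjacent[OF ij jk ik x p] by simp
    then show "\<phi> z * \<phi> x = \<phi> x * \<phi> z"
      using row_product_zero[OF ij ij a x] row_product_zero[OF ij ij x a]
        row_product_zero[OF ij ik a peirce_mult[OF x p]]
      by (simp add: z(2) mult.assoc right_diff_distrib) (simp add: mult.assoc[symmetric])
  qed (use z ij off_diagonal_mem in auto)
  note comm1 = centralizer_components[OF this]
  have "\<forall>x\<in>peirce j k. z * x = x * z"
  proof (intro ballI phi_commute_reflects)
    fix x assume x: "x \<in> peirce j k"
    have "\<phi> x * \<phi> a = \<phi> a * \<phi> x - \<phi> (a * x)"
      using phi_adjacent[OF ij jk ik a x] by simp
    then show "\<phi> z * \<phi> x = \<phi> x * \<phi> z"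
      using column_product_zero[OF jk jk p x] column_product_zero[OF jk jk x p]
        column_product_zero[OF ik jk peirce_mult[OF a x] p]
      by (simp add: z(2) mult.assoc[symmetric] left_diff_distrib) (simp add: mult.assoc)
  qed (use z jk off_diagonal_mem in auto)
  note comm2 = centralizer_components[OF this]
  have "e l * z * e m = 0" if lm: "l \<noteq> m" "l \<noteq> i \<or> m \<noteq> k" for l m
    using third_index[OF ij ik jk, of l] third_index[OF ij ik jk, of m]
      z(3-5) comm1(2)[of k] comm2(1)[of i] ij jk ik lm by auto
  then show ?thesis
    using z(1,2) by blast
qed

text \<open>
  The diagonal of \<open>z\<close> is central in \<open>A\<close>, hence invisible to brackets, so another representation of
  \<open>z\<close> is needed. Write \<open>a\<close> as a sum of products \<open>xp'q\<close> with \<open>x\<close>, \<open>p'\<close>, \<open>q\<close> in \<open>A\<^sub>i\<^sub>j\<close>, \<open>A\<^sub>j\<^sub>k\<close>, \<open>A\<^sub>k\<^sub>j\<close>, and put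
  \<open>t = \<phi>(q)\<phi>(p)\<close>, an element of \<open>B\<close> that need not lie in the range of \<open>\<phi>\<close>. Then
  \<open>\<phi>(a)\<phi>(p) = [\<phi>(xp'),t] = [[\<phi>(x),t],\<phi>(p')] + [\<phi>(x),[\<phi>(p'),t]]\<close>, where \<open>[\<phi>(x),t] = \<phi>(u)\<close> and
  \<open>[\<phi>(p'),t] = \<phi>(v)\<close> have so few components that \<open>[u,p'] + [x,v]\<close> has zero diagonal.
\<close>
lemma adjacent_product_peirce:
  assumes ij: "i \<noteq> j" and jk: "j \<noteq> k" and ik: "i \<noteq> k"
    and a: "a \<in> peirce i j" and p: "p \<in> peirce j k"
  shows "\<exists>z\<in>peirce i k. \<phi> z = \<phi> a * \<phi> p"
proof -
  have kj: "k \<noteq> j" using jk by simp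
  have step: "\<exists>z\<in>peirce i k. \<phi> z = \<phi> (b * q) * \<phi> p"
    if "b \<in> peirce i k" and q: "q \<in> peirce k j" for b q
    using that(1)
  proof (induction rule: peirce_mult_induct[where k = j])
    case (mult x p')
    have xL: "x \<in> L" and pL: "p' \<in> L"
      using off_diagonal_mem[OF ij mult(1)] off_diagonal_mem[OF jk mult(2)] by auto
    have b: "x * p' \<in> peirce i k" and bq: "x * p' * q \<in> peirce i j"
      and xp: "x * p \<in> peirce i k" and xpq: "x * p * q \<in> peirce i j"
      using mult p q peirce_mult by blast+
    have zeros: "\<phi> x * \<phi> q = 0" "\<phi> q * \<phi> x = 0" "\<phi> p * \<phi> p' = 0"
      "\<phi> (x * p') * \<phi> p = 0" "\<phi> p * \<phi> (x * p') = 0"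
      using column_product_zero[OF ij kj mult(1) q] column_product_zero[OF kj ij q mult(1)]
        column_product_zero[OF jk jk p mult(2)] column_product_zero[OF ik jk b p]
        column_product_zero[OF jk ik p b] by auto
    define t where "t = \<phi> q * \<phi> p"
    obtain u' where u': "u' \<in> L" "\<phi> u' = \<phi> (x * p) * \<phi> q"
      "\<And>l m. l \<noteq> m \<Longrightarrow> l \<noteq> i \<or> m \<noteq> j \<Longrightarrow> e l * u' * e m = 0"
      using adjacent_product_components[OF ik kj ij xp q] by blast
    define u where "u = u' - x * p * q"
    have u: "u \<in> L"
      unfolding u_def using u'(1) off_diagonal_mem[OF ij xpq] commutator_diff by blast
    have u_comp: "e l * u * e m = 0" if "l \<noteq> m" "l \<noteq> i \<or> m \<noteq> j" for l m
      using u'(3)[OF that] component_peirce[OF xpq, of l m] that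
      by (auto simp: u_def left_diff_distrib right_diff_distrib)
    have "\<phi> u = \<phi> q * \<phi> (x * p)"
      using phi_adjacent[OF ik kj ij xp q] phi_diff[OF u'(1) off_diagonal_mem[OF ij xpq]]
      by (simp add: u_def u'(2))
    also have "\<dots> = \<phi> x * t - t * \<phi> x"
      using zeros phi_adjacent[OF ij jk ik mult(1) p]
      by (simp add: t_def right_diff_distrib mult.assoc[symmetric])
    finally have \<phi>u: "\<phi> u = \<phi> x * t - t * \<phi> x" .
    obtain v where v: "v \<in> L" "\<phi> v = \<phi> p' * t - t * \<phi> p'"
      using phi_surj[OF commutator_mem] .
    have \<phi>v: "\<phi> v = \<phi> p' * \<phi> q * \<phi> p"
      using zeros by (simp add: v(2) t_def mult.assoc)
    have "\<forall>c\<in>peirce i k. v * c = c * v"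
    proof (intro ballI phi_commute_reflects)
      fix c assume c: "c \<in> peirce i k"
      show "\<phi> v * \<phi> c = \<phi> c * \<phi> v"
        using column_product_zero[OF jk ik p c] column_product_zero[OF ik jk c mult(2)]
        by (simp add: \<phi>v mult.assoc) (simp add: mult.assoc[symmetric])
    qed (use v ik off_diagonal_mem in auto)
    note v_comp = centralizer_components[OF this]
    have ji: "j \<noteq> i" using ij by simp
    define Z where "Z = (u * p' - p' * u) + (x * v - v * x)"
    have Z: "Z \<in> L"
      unfolding Z_def by (intro commutator_add commutator_mem)
    have "\<phi> Z = (\<phi> u * \<phi> p' - \<phi> p' * \<phi> u) + (\<phi> x * \<phi> v - \<phi> v * \<phi> x)"
      unfolding Z_def
      by (simp add: phi_add commutator_mem phi_bracket[OF u pL] phi_bracket[OF xL v(1)])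
    also have "\<dots> = \<phi> (x * p') * t - t * \<phi> (x * p')"
      by (simp add: \<phi>u v(2) phi_adjacent[OF ij jk ik mult] algebra_simps)
    also have "\<dots> = \<phi> (x * p' * q) * \<phi> p"
      using zeros phi_adjacent[OF ik kj ij b q]
      by (simp add: t_def left_diff_distrib mult.assoc)
    finally have \<phi>Z: "\<phi> Z = \<phi> (x * p' * q) * \<phi> p" .
    obtain z where z: "z \<in> L" "\<phi> z = \<phi> (x * p' * q) * \<phi> p"
      "\<And>l m. l \<noteq> m \<Longrightarrow> l \<noteq> i \<or> m \<noteq> k \<Longrightarrow> e l * z * e m = 0"
      using adjacent_product_components[OF ij jk ik bq p] by blast
    \<comment> \<open>The off-diagonal components are read off from \<open>z\<close>, the diagonal from the formula for \<open>Z\<close>.\<close>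
    have "z = Z"
      using phi_inj[OF z(1) Z] z(2) \<phi>Z by simp
    have diag: "e l * Z * e l = 0" for l
    proof -
      have "e l * (u * p') * e l = (e l * u * e j) * (p' * e l)"
        using mult(2) by (simp add: mult.assoc) (simp add: peirce_left mult.assoc[symmetric])
      also have "\<dots> = 0"
        using u_comp[of k j] kj ik peirce_right[OF mult(2), of l] by (cases "l = k") auto
      finally have 1: "e l * (u * p') * e l = 0" .
      have "e l * (p' * u) * e l = (e l * p') * (e k * u * e l)"
        using mult(2) by (simp add: mult.assoc[symmetric]) (simp add: peirce_right mult.assoc)
      also have "\<dots> = 0"
        using u_comp[of k j] kj ik peirce_left[OF mult(2), of l] by (cases "l = j") auto
      finally have 2: "e l * (p' * u) * e l = 0" .
      have "e l * (x * v) * e l = (e l * x) * (e j * v * e l)"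
        using mult(1) by (simp add: mult.assoc[symmetric]) (simp add: peirce_right mult.assoc)
      also have "\<dots> = 0"
        using v_comp(1)[OF ji] peirce_left[OF mult(1), of l] by (cases "l = i") auto
      finally have 3: "e l * (x * v) * e l = 0" .
      have "e l * (v * x) * e l = (e l * v * e i) * (x * e l)"
        using mult(1) by (simp add: mult.assoc) (simp add: peirce_left mult.assoc[symmetric])
      also have "\<dots> = 0"
        using v_comp(1)[OF ji] peirce_right[OF mult(1), of l] by (cases "l = j") auto
      finally have 4: "e l * (v * x) * e l = 0" .
      show ?thesis
        using 1 2 3 4 by (simp add: Z_def left_diff_distrib right_diff_distrib
            distrib_left distrib_right)
    qed
    have "e l * Z * e m = (if l = i \<and> m = k then e i * Z * e k else 0)" for l m
      using diag[of l] z(3) \<open>z = Z\<close> ik by (cases "l = m") auto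
    then have "(\<Sum>l\<in>UNIV. \<Sum>m\<in>UNIV. e l * Z * e m)
        = (\<Sum>l\<in>UNIV. \<Sum>m\<in>UNIV. if l = i \<and> m = k then e i * Z * e k else 0)"
      by (intro sum.cong refl)
    also have "\<dots> = e i * Z * e k"
      by (cases i; cases k) (simp_all add: UNIV_three)
    finally have "Z = e i * Z * e k"
      using peirce_decomposition[of Z] by simp
    then have "Z \<in> peirce i k"
      using peirce_component[of i Z k] by simp
    then show ?case
      using \<phi>Z by blast
  next
    case (diff x y)
    then obtain v w where "v \<in> peirce i k" "\<phi> v = \<phi> (x * q) * \<phi> p"
      "w \<in> peirce i k" "\<phi> w = \<phi> (y * q) * \<phi> p"
      by blast
    then show ?case
      using phi_off_diff[OF ik] phi_off_diff[OF ij peirce_mult[OF diff(1) q] peirce_mult[OF diff(2) q]]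
      by (intro bexI[of _ "v - w"]) (auto simp: peirce_diff left_diff_distrib)
  qed
  show ?thesis
    using a
  proof (induction rule: peirce_mult_induct[where k = k])
    case (mult b q)
    then show ?case using step by blast
  next
    case (diff x y)
    then obtain v w where "v \<in> peirce i k" "\<phi> v = \<phi> x * \<phi> p" "w \<in> peirce i k" "\<phi> w = \<phi> y * \<phi> p"
      by blast
    then show ?case
      using phi_off_diff[OF ik] phi_off_diff[OF ij] diff(1,2)
      by (intro bexI[of _ "v - w"]) (auto simp: peirce_diff left_diff_distrib)
  qed
qed

section \<open>The homomorphic and the antihomomorphic part\<close>

text \<open>
  If \<open>\<psi>\<^sub>1\<close> and \<open>\<psi>\<^sub>2\<close> exist, then on \<open>A\<^sub>i\<^sub>j\<close> this is the kernel of \<open>\<psi>\<^sub>2\<close>, and \<open>anti_part\<close> below is the kernel of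
  \<open>\<psi>\<^sub>1\<close>. For \<open>\<psi>\<^sub>2(c) = 0\<close> one has \<open>\<phi>(x)\<phi>(c) = \<psi>\<^sub>1(xc)\<close>, which is zero for \<open>x\<close> in \<open>A\<^sub>j\<^sub>k\<close> because then \<open>xc = 0\<close>.
\<close>
definition hom_part :: "three \<Rightarrow> three \<Rightarrow> 'a set"
  where "hom_part i j = {c \<in> peirce i j. \<forall>k. k \<noteq> i \<longrightarrow> k \<noteq> j \<longrightarrow>
    (\<forall>x\<in>peirce j k. \<phi> x * \<phi> c = 0) \<and> (\<forall>y\<in>peirce k i. \<phi> c * \<phi> y = 0)}"

definition anti_part :: "three \<Rightarrow> three \<Rightarrow> 'a set"
  where "anti_part i j = {c \<in> peirce i j. \<forall>k. k \<noteq> i \<longrightarrow> k \<noteq> j \<longrightarrow>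
    (\<forall>x\<in>peirce j k. \<phi> c * \<phi> x = 0) \<and> (\<forall>y\<in>peirce k i. \<phi> y * \<phi> c = 0)}"

lemma hom_part_peirce: "c \<in> hom_part i j \<Longrightarrow> c \<in> peirce i j"
  by (simp add: hom_part_def)

lemma anti_part_peirce: "c \<in> anti_part i j \<Longrightarrow> c \<in> peirce i j"
  by (simp add: anti_part_def)

lemma hom_part_right:
  "k \<noteq> i \<Longrightarrow> k \<noteq> j \<Longrightarrow> c \<in> hom_part i j \<Longrightarrow> x \<in> peirce j k \<Longrightarrow> \<phi> x * \<phi> c = 0"
  by (simp add: hom_part_def)

lemma hom_part_left:
  "k \<noteq> i \<Longrightarrow> k \<noteq> j \<Longrightarrow> c \<in> hom_part i j \<Longrightarrow> y \<in> peirce k i \<Longrightarrow> \<phi> c * \<phi> y = 0"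
  by (simp add: hom_part_def)

lemma anti_part_right:
  "k \<noteq> i \<Longrightarrow> k \<noteq> j \<Longrightarrow> c \<in> anti_part i j \<Longrightarrow> x \<in> peirce j k \<Longrightarrow> \<phi> c * \<phi> x = 0"
  by (simp add: anti_part_def)

lemma anti_part_left:
  "k \<noteq> i \<Longrightarrow> k \<noteq> j \<Longrightarrow> c \<in> anti_part i j \<Longrightarrow> y \<in> peirce k i \<Longrightarrow> \<phi> y * \<phi> c = 0"
  by (simp add: anti_part_def)

lemma hom_part_diff:
  "i \<noteq> j \<Longrightarrow> c \<in> hom_part i j \<Longrightarrow> d \<in> hom_part i j \<Longrightarrow> c - d \<in> hom_part i j"
  by (auto simp: hom_part_def peirce_diff phi_off_diff left_diff_distrib right_diff_distrib)

lemma anti_part_diff: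
  "i \<noteq> j \<Longrightarrow> c \<in> anti_part i j \<Longrightarrow> d \<in> anti_part i j \<Longrightarrow> c - d \<in> anti_part i j"
  by (auto simp: anti_part_def peirce_diff phi_off_diff left_diff_distrib right_diff_distrib)

text \<open>
  If \<open>\<phi>(c)\<close> annihilates \<open>\<phi>(x)\<close> on both sides, then \<open>cx = [c,x] = 0\<close>; and \<open>A\<^sub>j\<^sub>k\<close> is faithful.
\<close>
lemma parts_disjoint:
  assumes ij: "i \<noteq> j" and c: "c \<in> hom_part i j" "c \<in> anti_part i j"
  shows "c = 0"
proof -
  obtain k where k: "k \<noteq> i" "k \<noteq> j"
    using ex_third by blast
  have "c * e j = 0"
  proof (rule annihilator_right)
    fix x assume x: "x \<in> peirce j k"
    have "\<phi> (c * x) = 0"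
      using phi_adjacent[OF ij _ _ hom_part_peirce[OF c(1)] x] k
        hom_part_right[OF k c(1) x] anti_part_right[OF k c(2) x] by auto
    moreover have "c * x \<in> L"
      using off_diagonal_mem[of i k] k peirce_mult[OF hom_part_peirce[OF c(1)] x] by auto
    ultimately show "c * x = 0"
      using phi_inj[of "c * x" 0] by (simp add: phi_zero)
  qed
  then show ?thesis
    using peirce_right[OF hom_part_peirce[OF c(1)], of j] by simp
qed

text \<open>
  Multiplying \<open>\<phi>(a)\<phi>(p)\<close> or \<open>\<phi>(p)\<phi>(a)\<close> by an element of \<open>\<phi>(A\<^sub>k\<^sub>j)\<close> or \<open>\<phi>(A\<^sub>j\<^sub>i)\<close> on the appropriate side
  puts two factors from one row or from one column next to each other.
\<close>
lemma adjacent_product_split: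
  assumes ij: "i \<noteq> j" and jk: "j \<noteq> k" and ik: "i \<noteq> k"
    and a: "a \<in> peirce i j" and p: "p \<in> peirce j k"
  obtains z where "z \<in> hom_part i k" "a * p - z \<in> anti_part i k"
    "\<phi> z = \<phi> a * \<phi> p" "\<phi> (a * p - z) = - (\<phi> p * \<phi> a)"
proof -
  obtain z where z: "z \<in> peirce i k" "\<phi> z = \<phi> a * \<phi> p"
    using adjacent_product_peirce[OF ij jk ik a p] by blast
  have ap: "a * p \<in> peirce i k"
    using a p peirce_mult by blast
  have \<phi>d: "\<phi> (a * p - z) = - (\<phi> p * \<phi> a)"
    using phi_off_diff[OF ik ap z(1)] phi_adjacent[OF ij jk ik a p] z(2) by simp
  have kj: "k \<noteq> j" and ji: "j \<noteq> i" using jk ij by auto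
  have third: "l = j" if "l \<noteq> i" "l \<noteq> k" for l
    using third_index[OF ij ik jk, of l] that by simp
  have "\<phi> x * (\<phi> a * \<phi> p) = 0" "\<phi> p * \<phi> a * \<phi> x = 0" if x: "x \<in> peirce k j" for x
    using column_product_zero[OF kj ij x a] column_product_zero[OF ij kj a x]
    by (simp_all add: mult.assoc) (simp add: mult.assoc[symmetric])
  moreover have "\<phi> a * \<phi> p * \<phi> y = 0" "\<phi> y * (\<phi> p * \<phi> a) = 0" if y: "y \<in> peirce j i" for y
    using row_product_zero[OF ji jk y p] row_product_zero[OF jk ji p y]
    by (simp_all add: mult.assoc) (simp add: mult.assoc[symmetric])
  ultimately have "z \<in> hom_part i k" "a * p - z \<in> anti_part i k"
    using z ap \<phi>d peirce_diff third by (auto simp: hom_part_def anti_part_def dest!: third)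
  then show ?thesis
    using that z(2) \<phi>d by blast
qed

lemma split_exists:
  assumes ij: "i \<noteq> j" and b: "b \<in> peirce i j"
  shows "\<exists>c\<in>hom_part i j. b - c \<in> anti_part i j"
proof -
  obtain k where k: "k \<noteq> i" "k \<noteq> j"
    using ex_third by blast
  show ?thesis
    using b
  proof (induction rule: peirce_mult_induct[where k = k])
    case (mult a p)
    then show ?case
      using adjacent_product_split[of i k j a p] k ij by metis
  next
    case (diff a b)
    then obtain c d where "c \<in> hom_part i j" "a - c \<in> anti_part i j"
      "d \<in> hom_part i j" "b - d \<in> anti_part i j"
      by blast
    moreover from this have "(a - c) - (b - d) \<in> anti_part i j"
      using anti_part_diff[OF ij] by blast
    ultimately show ?case
      using hom_part_diff[OF ij] by (intro bexI[of _ "c - d"]) (auto simp: algebra_simps)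
  qed
qed

definition hom_proj :: "three \<Rightarrow> three \<Rightarrow> 'a \<Rightarrow> 'a"
  where "hom_proj i j x = (THE c. c \<in> hom_part i j \<and> e i * x * e j - c \<in> anti_part i j)"

lemma hom_proj_unique:
  assumes ij: "i \<noteq> j" and "c \<in> hom_part i j" "e i * x * e j - c \<in> anti_part i j"
    "d \<in> hom_part i j" "e i * x * e j - d \<in> anti_part i j"
  shows "c = d"
proof -
  have "c - d \<in> hom_part i j"
    using hom_part_diff assms by blast
  moreover have "c - d \<in> anti_part i j"
    using anti_part_diff[OF ij assms(5,3)] by simp
  ultimately show ?thesis
    using parts_disjoint[OF ij, of "c - d"] by simp
qed

lemma hom_proj_eqI:
  assumes "i \<noteq> j" and "c \<in> hom_part i j" "e i * x * e j - c \<in> anti_part i j"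
  shows "hom_proj i j x = c"
  unfolding hom_proj_def using assms hom_proj_unique by (intro the_equality) blast+

lemma hom_proj_props:
  assumes "i \<noteq> j"
  shows "hom_proj i j x \<in> hom_part i j" "e i * x * e j - hom_proj i j x \<in> anti_part i j"
  using split_exists[OF assms peirce_component[of i x j]] hom_proj_eqI[OF assms] by auto

lemma hom_proj_diff:
  assumes "i \<noteq> j"
  shows "hom_proj i j (x - y) = hom_proj i j x - hom_proj i j y"
proof (rule hom_proj_eqI[OF assms])
  show "hom_proj i j x - hom_proj i j y \<in> hom_part i j"
    using hom_part_diff hom_proj_props assms by blast
  have "(e i * x * e j - hom_proj i j x) - (e i * y * e j - hom_proj i j y) \<in> anti_part i j"
    using anti_part_diff hom_proj_props assms by blast
  then show "e i * (x - y) * e j - (hom_proj i j x - hom_proj i j y) \<in> anti_part i j"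
    by (simp add: algebra_simps)
qed

text \<open>
  These two families are the off-diagonal restrictions of \<open>\<psi>\<^sub>1\<close> and \<open>\<psi>\<^sub>2\<close>. They are set to zero on the
  diagonal so that they are additive for all indices.
\<close>
definition hom_component :: "three \<Rightarrow> three \<Rightarrow> 'a \<Rightarrow> 'b"
  where "hom_component i j x = (if i = j then 0 else \<phi> (hom_proj i j x))"

definition anti_component :: "three \<Rightarrow> three \<Rightarrow> 'a \<Rightarrow> 'b"
  where "anti_component i j x = (if i = j then 0 else - \<phi> (e i * x * e j - hom_proj i j x))"

lemma hom_component_additive: "additive (hom_component i j)"
  using phi_off_diff[OF _ hom_part_peirce[OF hom_proj_props(1)] hom_part_peirce[OF hom_proj_props(1)]]
  by (intro additiveI_diff) (simp add: hom_component_def hom_proj_diff)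

lemma anti_component_additive: "additive (anti_component i j)"
proof (rule additiveI_diff)
  fix x y
  have "e i * (x - y) * e j - hom_proj i j (x - y)
      = (e i * x * e j - hom_proj i j x) - (e i * y * e j - hom_proj i j y)" if "i \<noteq> j"
    using that by (simp add: hom_proj_diff algebra_simps)
  then show "anti_component i j (x - y) = anti_component i j x - anti_component i j y"
    using phi_off_diff[OF _ anti_part_peirce[OF hom_proj_props(2)] anti_part_peirce[OF hom_proj_props(2)]]
    by (simp add: anti_component_def)
qed

lemma component_cases:
  assumes "i \<noteq> j" "b \<in> peirce i j"
  obtains c d where "c \<in> hom_part i j" "d \<in> anti_part i j" "b = c + d"
    "hom_component i j b = \<phi> c" "anti_component i j b = - \<phi> d" "\<phi> b = \<phi> c + \<phi> d"
proof -
  have b: "e i * b * e j = b"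
    using assms by (simp add: component_peirce)
  have "\<phi> (hom_proj i j b + (b - hom_proj i j b)) = \<phi> (hom_proj i j b) + \<phi> (b - hom_proj i j b)"
    using hom_proj_props[OF assms(1), of b] off_diagonal_mem[OF assms(1)] b
      hom_part_peirce anti_part_peirce by (intro phi_add) auto
  then show ?thesis
    using that[of "hom_proj i j b" "b - hom_proj i j b"] hom_proj_props[OF assms(1), of b] assms(1) b
    by (simp add: hom_component_def anti_component_def)
qed

text \<open>
  In the product of \<open>\<phi>(a) = \<phi>(c) + \<phi>(d)\<close> and \<open>\<phi>(p) = \<phi>(q) + \<phi>(r)\<close>, with \<open>c\<close>, \<open>q\<close> in the homomorphic and
  \<open>d\<close>, \<open>r\<close> in the antihomomorphic parts, the defining conditions of the parts leave only \<open>\<phi>(c)\<phi>(q)\<close>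
  in one order and only \<open>\<phi>(r)\<phi>(d)\<close> in the other.
\<close>
lemma component_adjacent:
  assumes ij: "i \<noteq> j" and jk: "j \<noteq> k" and ik: "i \<noteq> k"
    and a: "a \<in> peirce i j" and p: "p \<in> peirce j k"
  shows "hom_component i j a * hom_component j k p = hom_component i k (a * p)"
    and "anti_component j k p * anti_component i j a = anti_component i k (a * p)"
    and "hom_component i j a * anti_component j k p = 0"
    and "anti_component j k p * hom_component i j a = 0"
    and "hom_component j k p * anti_component i j a = 0"
    and "anti_component i j a * hom_component j k p = 0"
proof -
  obtain c d where a': "c \<in> hom_part i j" "d \<in> anti_part i j"
    "hom_component i j a = \<phi> c" "anti_component i j a = - \<phi> d" "\<phi> a = \<phi> c + \<phi> d"
    using component_cases[OF ij a] by metis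
  obtain q r where p': "q \<in> hom_part j k" "r \<in> anti_part j k"
    "hom_component j k p = \<phi> q" "anti_component j k p = - \<phi> r" "\<phi> p = \<phi> q + \<phi> r"
    using component_cases[OF jk p] by metis
  have ki: "k \<noteq> i" and kj: "k \<noteq> j" using jk ik by auto
  have zeros: "\<phi> q * \<phi> c = 0" "\<phi> r * \<phi> c = 0" "\<phi> d * \<phi> q = 0" "\<phi> d * \<phi> r = 0"
    "\<phi> q * \<phi> d = 0" "\<phi> c * \<phi> r = 0"
    using hom_part_right[OF ki kj a'(1)] anti_part_right[OF ki kj a'(2)]
      hom_part_left[OF ij ik p'(1)] anti_part_left[OF ij ik p'(2)]
      hom_part_peirce[OF p'(1)] anti_part_peirce[OF p'(2)]
      hom_part_peirce[OF a'(1)] anti_part_peirce[OF a'(2)] by auto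
  obtain z where z: "z \<in> hom_part i k" "a * p - z \<in> anti_part i k"
    "\<phi> z = \<phi> a * \<phi> p" "\<phi> (a * p - z) = - (\<phi> p * \<phi> a)"
    using adjacent_product_split[OF ij jk ik a p] .
  have ap: "e i * (a * p) * e k = a * p"
    using component_peirce[OF peirce_mult[OF a p]] by simp
  have "hom_proj i k (a * p) = z"
    using hom_proj_eqI[OF ik z(1), of "a * p"] z(2) ap by simp
  then show "hom_component i j a * hom_component j k p = hom_component i k (a * p)"
    "anti_component j k p * anti_component i j a = anti_component i k (a * p)"
    using ik ap z(3,4) a'(5) p'(5) zeros
    by (simp_all add: a' p' hom_component_def[of i k] anti_component_def[of i k] distrib_left distrib_right)
  show "hom_component i j a * anti_component j k p = 0"
    "anti_component j k p * hom_component i j a = 0"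
    "hom_component j k p * anti_component i j a = 0"
    "anti_component i j a * hom_component j k p = 0"
    by (simp_all add: a' p' zeros)
qed

lemma component_range:
  assumes "i \<noteq> j" "a \<in> peirce i j"
  shows "\<exists>c\<in>peirce i j. hom_component i j a = \<phi> c"
    "\<exists>c\<in>peirce i j. anti_component i j a = - \<phi> c"
  using component_cases[OF assms] hom_part_peirce anti_part_peirce by metis+

lemma parallel_product_zero:
  assumes "i \<noteq> j" "k \<noteq> l" "a \<in> peirce i j" "b \<in> peirce k l" "i = k \<or> j = l"
  shows "\<phi> a * \<phi> b = 0"
  using assms row_product_zero[of i j l a b] column_product_zero[of i j k a b] by auto

text \<open>
  If neither the rows nor the columns agree, the only remaining position of the second factor is
  \<open>A\<^sub>k\<^sub>i\<close> with \<open>k\<close> the third index, where the definition of the parts applies.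
\<close>
lemma component_mismatch:
  assumes ij: "i \<noteq> j" and kl: "k \<noteq> l" and jk: "j \<noteq> k"
    and a: "a \<in> peirce i j" and b: "b \<in> peirce k l"
  shows "hom_component i j a * hom_component k l b = 0"
    and "anti_component k l b * anti_component i j a = 0"
proof -
  obtain c d where a': "c \<in> hom_part i j" "d \<in> anti_part i j"
    "hom_component i j a = \<phi> c" "anti_component i j a = - \<phi> d"
    using component_cases[OF ij a] by metis
  obtain q r where b': "q \<in> peirce k l" "r \<in> peirce k l"
    "hom_component k l b = \<phi> q" "anti_component k l b = - \<phi> r"
    using component_range[OF kl b] by metis
  have "\<phi> c * \<phi> q = 0 \<and> \<phi> r * \<phi> d = 0"
  proof (cases "i = k \<or> j = l")
    case True
    then show ?thesis
      using parallel_product_zero[OF ij kl hom_part_peirce[OF a'(1)] b'(1)]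
        parallel_product_zero[OF kl ij b'(2) anti_part_peirce[OF a'(2)]] by auto
  next
    case False
    then have "l = i"
      using third_index[of i j k l] ij kl jk by auto
    then show ?thesis
      using False jk b' hom_part_left[of k i j c q] anti_part_left[of k i j d r] a' by auto
  qed
  then show "hom_component i j a * hom_component k l b = 0"
    "anti_component k l b * anti_component i j a = 0"
    by (simp_all add: a' b')
qed

text \<open>
  All positions except opposite ones, \<open>A\<^sub>i\<^sub>j\<close> and \<open>A\<^sub>j\<^sub>i\<close>, are covered by the relations above. In the
  opposite case factor the element of \<open>A\<^sub>i\<^sub>j\<close> through the third index.
\<close>
lemma components_orthogonal:
  assumes ij: "i \<noteq> j" and kl: "k \<noteq> l" and a: "a \<in> peirce i j" and b: "b \<in> peirce k l"
  shows "hom_component i j a * anti_component k l b = 0 \<and>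
    anti_component k l b * hom_component i j a = 0"
proof -
  have generic: "hom_component i j a * anti_component k l b = 0 \<and>
    anti_component k l b * hom_component i j a = 0"
    if ij: "i \<noteq> j" and kl: "k \<noteq> l" and a: "a \<in> peirce i j" and b: "b \<in> peirce k l"
      and not_opposite: "k \<noteq> j \<or> l \<noteq> i" for i j k l a b
  proof -
    consider "i = k \<or> j = l" | "j = k" "i \<noteq> l" | "l = i" "k \<noteq> j"
      using third_index[of i j k l] ij kl not_opposite by blast
    then show ?thesis
    proof cases
      case 1
      then show ?thesis
        using component_range(1)[OF ij a] component_range(2)[OF kl b]
          parallel_product_zero[OF ij kl] parallel_product_zero[OF kl ij] by auto
    next
      case 2
      then show ?thesis
        using component_adjacent(3,4)[of i j l a b] ij kl a b by auto
    next
      case 3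
      then show ?thesis
        using component_adjacent(5,6)[of k i j b a] ij kl a b by auto
    qed
  qed
  show ?thesis
  proof (cases "k = j \<and> l = i")
    case False
    then show ?thesis using generic assms by blast
  next
    case True
    obtain n where n: "n \<noteq> i" "n \<noteq> j"
      using ex_third by blast
    interpret hom: additive "hom_component i j"
      by (rule hom_component_additive)
    show ?thesis
      using a
    proof (induction rule: peirce_mult_induct[where k = n])
      case (mult x y)
      have xy: "hom_component i j (x * y) = hom_component i n x * hom_component n j y"
        using component_adjacent(1)[of i n j x y] n ij mult by auto
      have "hom_component n j y * anti_component k l b = 0"
        "anti_component k l b * hom_component i n x = 0"
        using generic[of n j k l y b] generic[of i n k l x b] True n ij kl mult b by auto
      then show ?case
        by (simp add: xy mult.assoc) (simp add: mult.assoc[symmetric])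
    next
      case (diff x y)
      then show ?case
        by (simp add: hom.diff left_diff_distrib right_diff_distrib)
    qed
  qed
qed

section \<open>The standard extension\<close>

text \<open>
  A standard map sends brackets to brackets because the mixed products of \<open>\<psi>\<^sub>1\<close> and \<open>\<psi>\<^sub>2\<close> vanish, so
  agreement with \<open>\<phi>\<close> on the off-diagonal components propagates to \<open>L\<close>.
\<close>
theorem standard_extension:
  "\<exists>\<Phi>. standard_map \<Phi> \<and> (\<forall>x\<in>L. \<Phi> x = \<phi> x)"
proof -
  have mult_additive: "additive (\<lambda>s. s * t)" "additive (\<lambda>s. t * s)" for t :: 'b
    by (simp_all add: additive_def distrib_left distrib_right)
  obtain \<psi>1 where \<psi>1: "additive \<psi>1" "\<And>x y. \<psi>1 (x * y) = \<psi>1 x * \<psi>1 y"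
    and \<psi>1_off: "\<And>i j x. i \<noteq> j \<Longrightarrow> x \<in> peirce i j \<Longrightarrow> \<psi>1 x = hom_component i j x"
  proof (rule multiplicative_extension[where m = "\<lambda>s t. s * t" and \<theta> = hom_component])
  qed (use mult_additive hom_component_additive component_adjacent(1) component_mismatch(1)
      in \<open>auto simp: mult.assoc\<close>)
  obtain \<psi>2 where \<psi>2: "additive \<psi>2" "\<And>x y. \<psi>2 (x * y) = \<psi>2 y * \<psi>2 x"
    and \<psi>2_off: "\<And>i j x. i \<noteq> j \<Longrightarrow> x \<in> peirce i j \<Longrightarrow> \<psi>2 x = anti_component i j x"
  proof (rule multiplicative_extension[where m = "\<lambda>s t. t * s" and \<theta> = anti_component])
  qed (use mult_additive anti_component_additive component_adjacent(2) component_mismatch(2)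
      in \<open>auto simp: mult.assoc\<close>)
  interpret \<psi>1: additive \<psi>1 by (rule \<psi>1)
  interpret \<psi>2: additive \<psi>2 by (rule \<psi>2)
  have orth: "\<forall>y. \<psi>1 x * \<psi>2 y = 0 \<and> \<psi>2 y * \<psi>1 x = 0" for x
  proof (induction x rule: generate_induct)
    case (peirce i j x)
    have "\<psi>1 x * \<psi>2 y = 0 \<and> \<psi>2 y * \<psi>1 x = 0" for y
    proof (induction y rule: generate_induct)
      case (peirce k l y)
      then show ?case
        using components_orthogonal \<open>i \<noteq> j\<close> \<open>x \<in> peirce i j\<close> by (simp add: \<psi>1_off \<psi>2_off)
    next
      case (diff y z)
      then show ?case
        by (simp add: \<psi>2.diff left_diff_distrib right_diff_distrib)
    next
      case (mult y z)
      then show ?case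
        by (simp add: \<psi>2(2) mult.assoc) (simp add: mult.assoc[symmetric])
    qed
    then show ?case by blast
  next
    case (diff x y)
    then show ?case
      by (simp add: \<psi>1.diff left_diff_distrib right_diff_distrib)
  next
    case (mult x y)
    then show ?case
      by (simp add: \<psi>1(2) mult.assoc) (simp add: mult.assoc[symmetric])
  qed
  define \<Phi> where "\<Phi> x = \<psi>1 x - \<psi>2 x" for x
  have \<Phi>_diff: "\<Phi> (x - y) = \<Phi> x - \<Phi> y" for x y
    by (simp add: \<Phi>_def \<psi>1.diff \<psi>2.diff)
  have \<Phi>_bracket: "\<Phi> (x * y - y * x) = \<Phi> x * \<Phi> y - \<Phi> y * \<Phi> x" for x y
    using orth by (simp add: \<Phi>_def \<psi>1.diff \<psi>2.diff \<psi>1(2) \<psi>2(2) left_diff_distrib right_diff_distrib)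
  have \<Phi>_off: "\<Phi> x = \<phi> x" if "i \<noteq> j" "x \<in> peirce i j" for i j x
    using component_cases[OF that] by (metis \<Phi>_def \<psi>1_off \<psi>2_off diff_minus_eq_add that)
  have "\<Phi> x = \<phi> x" if "x \<in> L" for x
    using that
  proof (induction rule: commutator_induct)
    case (off_diagonal i j x)
    then show ?case by (rule \<Phi>_off)
  next
    case (diff x y)
    then show ?case by (simp add: \<Phi>_diff phi_diff)
  next
    case (bracket i j x y)
    then show ?case
      using phi_bracket[of x y] off_diagonal_mem[of i j x] off_diagonal_mem[of j i y]
        \<Phi>_off[of i j x] \<Phi>_off[of j i y] by (simp add: \<Phi>_bracket)
  qed
  moreover have "ring_homomorphism \<psi>1" "ring_antihomomorphism \<psi>2"
    using \<psi>1 \<psi>2 by (simp_all add: ring_homomorphism_def ring_antihomomorphism_def)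
  then have "standard_map \<Phi>"
    unfolding standard_map_def
    using orth additiveI_diff[of \<Phi>, OF \<Phi>_diff] \<Phi>_def by metis
  ultimately show ?thesis by blast
qed

end

theorem theorem1:
  fixes e\<^sub>1 e\<^sub>2 e\<^sub>3 :: "'a::{ring, monoid_mult}"
    and \<phi> :: "'a \<Rightarrow> 'b::ring"
  assumes "full_idempotent e\<^sub>1" "full_idempotent e\<^sub>2" "full_idempotent e\<^sub>3"
    and "orthogonal_elements e\<^sub>1 e\<^sub>2" "orthogonal_elements e\<^sub>1 e\<^sub>3" "orthogonal_elements e\<^sub>2 e\<^sub>3"
    and "e\<^sub>1 + e\<^sub>2 + e\<^sub>3 = 1"
    and "lie_ring_iso_on commutator_subgroup commutator_subgroup \<phi>"
  shows "\<exists>\<Phi> :: 'a \<Rightarrow> 'b. standard_map \<Phi> \<and> (\<forall>a\<in>commutator_subgroup. \<Phi> a = \<phi> a)"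
proof -
  define e where "e = case_three e\<^sub>1 e\<^sub>2 e\<^sub>3"
  interpret lie_iso_frame e \<phi>
  proof
    show "full_idempotent (e i)" for i
      using assms(1-3) by (cases i) (simp_all add: e_def)
    show "e i * e j = 0" if "i \<noteq> j" for i j
      using assms(4-6) that
      by (cases i; cases j) (simp_all add: e_def orthogonal_elements_def)
    show "e One + e Two + e Three = 1"
      using assms(7) by (simp add: e_def)
  qed (rule assms(8))
  show ?thesis
    by (rule standard_extension)
qed

end
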